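(* Let $h$ be a $C^2$ function on $\mathbb{R}^+=(0,\infty)$ such that (A-3) $t\,(h'(t))^2+2t\,h''(t)+2n\,h'(t)\ge0$ for all $t>0$, and (A-4) $\int_0^r e^{h(t)}t^{n-2}\,dt<+\infty$ for every $r>0$. Let $f(x)=e^{h(|x|)}$. Then every oriented stable minimal hypercone in $\mathbb{R}^n$ is also $f$-stable.
   Context: A minimal hypercone is a cone $\mathcal{C}=C(\Sigma)=\{tx:t\ge0,\ x\in\Sigma\}\subset\mathbb{R}^n$ of dimension $k=n-1$ over a closed smooth minimal hypersurface $\Sigma$ of the unit sphere $S^{n-1}(1)$. Put $\mathcal{E}_f(M)=\int_M f\,d\mathcal{H}_k$ ($\mathcal{H}_k$ is $k$-dimensional Hausdorff measure). Let $D$ be the flat connection of $\mathbb{R}^n$, let $(\cdot)^\perp$ be the normal projection, let $\mathbf{B}(X,Y)=(D_XY)^\perp$, let $e_1,\dots,e_k$ be a local orthonormal tangent frame, and let $\mathbf{H}=\sum_i\mathbf{B}(e_i,e_i)$. A $C^2$ submanifold $M$ is $f$-stationary in $U=\mathbb{R}^n\setminus\{0\}$ if the first variation of $\mathcal{E}_f$ vanishes for deformations compactly supported in $U$ (equivalently $f\mathbf{H}=(Df)^\perp$ on $M\cap U$; minimal cones satisfy this for radial $f$). It is then $f$-stable if for every $C^1$ normal vector field $X$ along $M$ with compact support in $M\cap U$, $$\int_M f\Big[\sum_{i,j=1}^k\langle\mathbf{B}(e_i,e_j),X\rangle^2+\langle\mathbf{H},X\rangle^2\Big]d\mathcal{H}_k\le\int_M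 \Big(f\sum_{i=1}^k|(D_{e_i}X)^\perp|^2+\mathrm{Hess} f(X,X)\Big)d\mathcal{H}_k .$$ For a cone this is applied to its regular part $M=\mathcal{C}\setminus\{0\}$, i.e. with normal fields compactly supported away from the origin. "Stable" (for the area functional) means the same inequality with $f\equiv1$. *)

theory Defs
  imports "HOL-Analysis.Analysis" "HOL-Library.Extended_Nat"
begin

text \<open>Functions of class \<open>C\<^sup>r\<close> (\<open>r = \<infinity>\<close> allowed) on an open set: all iterated directional derivatives
  of order at most \<open>r\<close> exist and are continuous.\<close>

primrec nat_Cr_on :: "nat \<Rightarrow> ('a::real_normed_vector \<Rightarrow> 'b::real_normed_vector) \<Rightarrow> 'a set \<Rightarrow> bool" where
  "nat_Cr_on 0 f U \<longleftrightarrow> continuous_on U f"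
| "nat_Cr_on (Suc r) f U \<longleftrightarrow>
     (\<forall>x\<in>U. f differentiable (at x)) \<and> (\<forall>v. nat_Cr_on r (\<lambda>x. frechet_derivative f (at x) v) U)"

definition Cr_on :: "enat \<Rightarrow> ('a::real_normed_vector \<Rightarrow> 'b::real_normed_vector) \<Rightarrow> 'a set \<Rightarrow> bool" where
  "Cr_on r f U \<longleftrightarrow> (\<forall>j::nat. enat j \<le> r \<longrightarrow> nat_Cr_on j f U)"

definition gradient :: "('a::euclidean_space \<Rightarrow> real) \<Rightarrow> 'a \<Rightarrow> 'a" where
  "gradient f x = (THE D. GDERIV f x :> D)"

definition Hess :: "('a::euclidean_space \<Rightarrow> real) \<Rightarrow> 'a \<Rightarrow> 'a \<Rightarrow> 'a \<Rightarrow> real" where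
  "Hess f x v w = frechet_derivative (\<lambda>y. frechet_derivative f (at y) v) (at x) w"

text \<open>The \<open>s\<close>-dimensional Hausdorff measure, normalised to agree with Lebesgue measure on
  \<open>s\<close>-dimensional Euclidean space. The outer measure is restricted to the Borel sets. Empty covering
  sets contribute nothing; this has to be said explicitly because \<open>0 ^ 0 = 1\<close>.\<close>

definition hausdorff_premeasure :: "nat \<Rightarrow> real \<Rightarrow> 'a::euclidean_space set \<Rightarrow> ennreal" where
  "hausdorff_premeasure s \<delta> A =
     (INF C \<in> {C :: nat \<Rightarrow> 'a set. A \<subseteq> (\<Union>i. C i) \<and> (\<forall>i. bounded (C i) \<and> diameter (C i) \<le> \<delta>)}.
        \<Sum>i. if C i = {} then 0 else ennreal (unit_ball_vol (real s) * (diameter (C i) / 2) ^ s))"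

definition hausdorff_outer :: "nat \<Rightarrow> 'a::euclidean_space set \<Rightarrow> ennreal" where
  "hausdorff_outer s A = (SUP \<delta> \<in> {0<..}. hausdorff_premeasure s \<delta> A)"

definition hausdorff_measure :: "nat \<Rightarrow> 'a::euclidean_space measure" where
  "hausdorff_measure s = measure_of UNIV (sets borel) (hausdorff_outer s)"

text \<open>Embedded \<open>k\<close>-dimensional submanifolds of class \<open>C\<^sup>r\<close>, without boundary: locally \<open>M\<close> is
  flattened to a \<open>k\<close>-dimensional linear subspace by a \<open>C\<^sup>r\<close> diffeomorphism of the ambient space.\<close>

definition submanifold :: "enat \<Rightarrow> nat \<Rightarrow> 'a::euclidean_space set \<Rightarrow> bool" where
  "submanifold r k M \<longleftrightarrow>
     (\<forall>p\<in>M. \<exists>U V (\<Phi>::'a \<Rightarrow> 'a) (\<Psi>::'a \<Rightarrow> 'a) (S::'a set).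
        open U \<and> p \<in> U \<and> open V \<and> homeomorphism U V \<Phi> \<Psi> \<and> Cr_on r \<Phi> U \<and> Cr_on r \<Psi> V \<and>
        subspace S \<and> dim S = k \<and> \<Phi> ` (M \<inter> U) = S \<inter> V)"

definition tangent_space :: "'a::euclidean_space set \<Rightarrow> 'a \<Rightarrow> 'a set" where
  "tangent_space M p =
     {v. \<exists>\<gamma>::real \<Rightarrow> 'a. \<exists>\<epsilon>>0. (\<forall>t. \<bar>t\<bar> < \<epsilon> \<longrightarrow> \<gamma> t \<in> M) \<and> \<gamma> 0 = p \<and>
           (\<gamma> has_vector_derivative v) (at 0)}"

text \<open>The normal projection \<open>v \<mapsto> v\<^sup>\<bottom>\<close> at the point \<open>p\<close> of \<open>M\<close>.\<close>

definition normal_part :: "'a::euclidean_space set \<Rightarrow> 'a \<Rightarrow> 'a \<Rightarrow> 'a" where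
  "normal_part M p v =
     (THE w. w \<in> orthogonal_comp (tangent_space M p) \<and> v - w \<in> tangent_space M p)"

text \<open>An orthonormal basis of the tangent space. It is only used inside traces, which do not depend
  on the choice.\<close>

definition tangent_frame :: "'a::euclidean_space set \<Rightarrow> 'a \<Rightarrow> 'a set" where
  "tangent_frame M p =
     (SOME B. pairwise orthogonal B \<and> (\<forall>b\<in>B. norm b = 1) \<and> span B = tangent_space M p)"

text \<open>Vector fields along \<open>M\<close> are represented by functions on the whole space; only their values on
  \<open>M\<close> matter. Being \<open>C\<^sup>1\<close> along \<open>M\<close> means having local \<open>C\<^sup>1\<close> extensions.\<close>

definition C1_along :: "'a::euclidean_space set \<Rightarrow> ('a \<Rightarrow> 'a) \<Rightarrow> bool" where
  "C1_along M X \<longleftrightarrow>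
     (\<forall>p\<in>M. \<exists>U F. open U \<and> p \<in> U \<and> Cr_on 1 F U \<and> (\<forall>x\<in>M \<inter> U. F x = X x))"

definition tangent_field :: "'a::euclidean_space set \<Rightarrow> ('a \<Rightarrow> 'a) \<Rightarrow> bool" where
  "tangent_field M Y \<longleftrightarrow> C1_along M Y \<and> (\<forall>x\<in>M. Y x \<in> tangent_space M x)"

definition normal_field :: "'a::euclidean_space set \<Rightarrow> ('a \<Rightarrow> 'a) \<Rightarrow> bool" where
  "normal_field M X \<longleftrightarrow> C1_along M X \<and> (\<forall>x\<in>M. X x \<in> orthogonal_comp (tangent_space M x))"

text \<open>\<open>D\<^sub>u X\<close> for the flat connection and a field \<open>X\<close> along \<open>M\<close>. A derivative within \<open>M\<close> is unique
  only on the tangent space, so this is meaningful for tangent vectors \<open>u\<close>.\<close>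

definition flat_deriv :: "'a::euclidean_space set \<Rightarrow> ('a \<Rightarrow> 'a) \<Rightarrow> 'a \<Rightarrow> 'a \<Rightarrow> 'a" where
  "flat_deriv M X p u = frechet_derivative X (at p within M) u"

text \<open>\<open>B(u, v) = (D\<^sub>u Y)\<^sup>\<bottom>\<close> for tangent vectors \<open>u\<close>, \<open>v\<close> at \<open>p\<close>, where \<open>Y\<close> is any tangent field with
  \<open>Y p = v\<close>; the value does not depend on the extension \<open>Y\<close>.\<close>

definition second_ff :: "'a::euclidean_space set \<Rightarrow> 'a \<Rightarrow> 'a \<Rightarrow> 'a \<Rightarrow> 'a" where
  "second_ff M p u v =
     normal_part M p (flat_deriv M (SOME Y. tangent_field M Y \<and> Y p = v) p u)"

definition mean_curvature :: "'a::euclidean_space set \<Rightarrow> 'a \<Rightarrow> 'a" where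
  "mean_curvature M p = (\<Sum>e\<in>tangent_frame M p. second_ff M p e e)"

text \<open>For \<open>M\<close> in the unit sphere, the normal space of \<open>M\<close> at \<open>p\<close> within the sphere is the
  orthogonal complement of \<open>p\<close> in the Euclidean normal space, hence the subtraction.\<close>

definition sphere_second_ff :: "'a::euclidean_space set \<Rightarrow> 'a \<Rightarrow> 'a \<Rightarrow> 'a \<Rightarrow> 'a" where
  "sphere_second_ff M p u v = second_ff M p u v - (second_ff M p u v \<bullet> p) *\<^sub>R p"

definition sphere_mean_curvature :: "'a::euclidean_space set \<Rightarrow> 'a \<Rightarrow> 'a" where
  "sphere_mean_curvature M p = (\<Sum>e\<in>tangent_frame M p. sphere_second_ff M p e e)"

definition closed_minimal_hypersurface_of_sphere :: "'a::euclidean_space set \<Rightarrow> bool" where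
  "closed_minimal_hypersurface_of_sphere S \<longleftrightarrow>
     S \<subseteq> sphere 0 1 \<and> compact S \<and> submanifold \<infinity> (DIM('a) - 2) S \<and>
     (\<forall>p\<in>S. sphere_mean_curvature S p = 0)"

definition cone_over :: "'a::euclidean_space set \<Rightarrow> 'a set" where
  "cone_over S = {t *\<^sub>R x | t x. 0 \<le> t \<and> x \<in> S}"

definition minimal_hypercone :: "'a::euclidean_space set \<Rightarrow> bool" where
  "minimal_hypercone C \<longleftrightarrow> (\<exists>S. closed_minimal_hypersurface_of_sphere S \<and> C = cone_over S)"

text \<open>An orientation of a hypersurface of Euclidean space, given as a continuous unit normal.\<close>

definition orientation_of :: "'a::euclidean_space set \<Rightarrow> ('a \<Rightarrow> 'a) \<Rightarrow> bool" where
  "orientation_of M \<nu> \<longleftrightarrow> continuous_on M \<nu> \<and>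
     (\<forall>x\<in>M. norm (\<nu> x) = 1 \<and> \<nu> x \<in> orthogonal_comp (tangent_space M x))"

text \<open>Stationarity of \<open>M \<mapsto> \<integral>\<^sub>M f d\<H>\<^sub>k\<close> in \<open>U\<close>, expressed by its Euler--Lagrange equation
  \<open>f H = (D f)\<^sup>\<bottom>\<close>.\<close>

definition f_stationary :: "nat \<Rightarrow> 'a::euclidean_space set \<Rightarrow> ('a \<Rightarrow> real) \<Rightarrow> 'a set \<Rightarrow> bool" where
  "f_stationary k U f M \<longleftrightarrow> submanifold 2 k M \<and>
     (\<forall>x\<in>M \<inter> U. f x *\<^sub>R mean_curvature M x = normal_part M x (gradient f x))"

definition f_stable :: "nat \<Rightarrow> 'a::euclidean_space set \<Rightarrow> ('a \<Rightarrow> real) \<Rightarrow> 'a set \<Rightarrow> bool" where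
  "f_stable k U f M \<longleftrightarrow> f_stationary k U f M \<and>
     (\<forall>X. normal_field M X \<and> (\<exists>K. compact K \<and> K \<subseteq> M \<inter> U \<and> (\<forall>x\<in>M - K. X x = 0)) \<longrightarrow>
        (LINT x:M|hausdorff_measure k.
           f x * ((\<Sum>u\<in>tangent_frame M x. \<Sum>v\<in>tangent_frame M x. (second_ff M x u v \<bullet> X x)\<^sup>2)
                  + (mean_curvature M x \<bullet> X x)\<^sup>2))
        \<le> (LINT x:M|hausdorff_measure k.
           f x * (\<Sum>u\<in>tangent_frame M x. (norm (normal_part M x (flat_deriv M X x u)))\<^sup>2)
           + Hess f x (X x) (X x)))"

text \<open>For a cone \<open>C\<close>, (\<open>f\<close>-)stability refers to the regular part \<open>C - {0}\<close>. Stability for the area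
  functional is the case \<open>f = 1\<close>.\<close>

definition f_stable_hypercone :: "('a::euclidean_space \<Rightarrow> real) \<Rightarrow> 'a set \<Rightarrow> bool" where
  "f_stable_hypercone f C \<longleftrightarrow> f_stable (DIM('a) - 1) (- {0}) f (C - {0})"

definition stable_hypercone :: "'a::euclidean_space set \<Rightarrow> bool" where
  "stable_hypercone C \<longleftrightarrow> f_stable_hypercone (\<lambda>_. 1) C"

end

theory Submission
  imports Defs
begin

text \<open>For a normal field \<open>X\<close> with compact support, test the area stability of the cone with the field
  \<open>Y = e\<^sup>h\<^sup>/\<^sup>2 X\<close>. Since \<open>H = 0\<close>, the curvature terms for \<open>(1, Y)\<close> and \<open>(f, X)\<close> coincide. As the gradient of
  a radial function is tangent to the cone, the energy density of \<open>Y\<close> is \<open>f |(DX)\<^sup>\<bottom>|\<^sup>2\<close> plus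
  \<open>f (h' \<langle>X, D\<^sub>r X\<rangle> + h'\<^sup>2 |X|\<^sup>2 / 4)\<close>. Integrating the term with \<open>D\<^sub>r X\<close> by parts along the rays, (A-3) says
  exactly that the extra terms are at most \<open>Hess f (X, X) = f h' |X|\<^sup>2 / |x|\<close>.\<close>

section \<open>Hausdorff measure\<close>

text \<open>The weight of \<open>Y\<close> is the square root of the density. Both curvature terms
  are quadratic in the field, so the factor f appears pointwise and \<open>second_ff\<close> never
  has to be evaluated. Two obstacles shape the rest. The measure is a Hausdorff outer measure
  restricted to the Borel sets, with no product decomposition of the cone at hand. Only two facts
  are extracted from it, homogeneity \<open>c ^ k\<close> under homotheties and finiteness on
  compact subsets of the cone, and they carry the integration by parts. Tangent spaces, projections,
  frames and derivatives within \<open>M\<close> are defined through curves and choice operators, so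
  each is tied to a chart or a local extension before it is computed with. The frame is chosen
  independently at every point, and no measurability is established for sums over it. The energy
  comparison therefore isolates that sum in one term common to both sides and falls back on the
  value 0 of non-integrable integrals.\<close>

lemma ennreal_le_cmult_iff:
  assumes "c > 0"
  shows "a \<le> ennreal c * b \<longleftrightarrow> ennreal (1 / c) * a \<le> b"
proof -
  have inv: "ennreal (1 / c) * ennreal c = 1" "ennreal c * ennreal (1 / c) = 1"
    using assms by (simp_all flip: ennreal_mult')
  show ?thesis
  proof
    assume "a \<le> ennreal c * b"
    then have "ennreal (1 / c) * a \<le> ennreal (1 / c) * (ennreal c * b)"
      by (rule mult_left_mono) simp
    then show "ennreal (1 / c) * a \<le> b"
      by (simp only: inv mult.assoc[symmetric] mult_1_left)
  next
    assume "ennreal (1 / c) * a \<le> b"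
    then have "ennreal c * (ennreal (1 / c) * a) \<le> ennreal c * b"
      by (rule mult_left_mono) simp
    then show "a \<le> ennreal c * b"
      by (simp only: inv mult.assoc[symmetric] mult_1_left)
  qed
qed

section \<open>Hausdorff outer measure: Lipschitz images, scaling, local finiteness\<close>

lemma hausdorff_premeasure_lipschitz_image:
  fixes f :: "'a::euclidean_space \<Rightarrow> 'b::euclidean_space"
  assumes "L > 0" and lip: "\<And>x y. x \<in> A \<Longrightarrow> y \<in> A \<Longrightarrow> dist (f x) (f y) \<le> L * dist x y"
  shows "hausdorff_premeasure s (L * \<delta>) (f ` A) \<le> ennreal (L ^ s) * hausdorff_premeasure s \<delta> A"
proof -
  let ?v = "\<lambda>C :: 'a set. if C = {} then 0 else ennreal (unit_ball_vol (real s) * (diameter C / 2) ^ s)"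
  let ?w = "\<lambda>C :: 'b set. if C = {} then 0 else ennreal (unit_ball_vol (real s) * (diameter C / 2) ^ s)"
  \<comment> \<open>The factor \<open>L ^ s\<close> is moved to the left, so that the infimum over
    coverings stands alone on the right and it suffices to bound each covering separately.\<close>
  have "ennreal (1 / L ^ s) * hausdorff_premeasure s (L * \<delta>) (f ` A) \<le> (\<Sum>i. ?v (C i))"
    if C: "A \<subseteq> (\<Union>i. C i)" "\<forall>i. bounded (C i) \<and> diameter (C i) \<le> \<delta>" for C :: "nat \<Rightarrow> 'a set"
  proof -
    \<comment> \<open>Only \<open>A \<inter> C i\<close> is mapped, because the Lipschitz bound
      holds only on \<open>A\<close>. Such a piece may be empty although \<open>C i\<close> is not,
      hence the case distinction in the comparison of terms.\<close>
    define C' where "C' i = f ` (A \<inter> C i)" for i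
    have d: "dist (f x) (f y) \<le> L * diameter (C i)" if "x \<in> A \<inter> C i" "y \<in> A \<inter> C i" for x y i
      using lip[of x y] that C(2) diameter_bounded_bound[of "C i" x y] \<open>L > 0\<close>
      by (meson IntD1 IntD2 mult_left_mono less_imp_le order_trans)
    have bd: "bounded (C' i)" for i
      unfolding bounded_two_points C'_def using d[of _ i] by (intro exI[of _ "L * diameter (C i)"]) auto
    have diam: "diameter (C' i) \<le> L * diameter (C i)" for i
      unfolding C'_def
      by (rule diameter_le) (use d[of _ i] C(2) \<open>L > 0\<close> in \<open>auto simp: dist_norm diameter_ge_0\<close>)
    have "hausdorff_premeasure s (L * \<delta>) (f ` A) \<le> (\<Sum>i. ?w (C' i))"
      unfolding hausdorff_premeasure_def
    proof (rule INF_lower, safe)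
      show "f x \<in> (\<Union>i. C' i)" if "x \<in> A" for x
        using that C(1) unfolding C'_def by blast
      show "diameter (C' i) \<le> L * \<delta>" for i
        using diam[of i] C(2) \<open>L > 0\<close> by (meson mult_left_mono less_imp_le order_trans)
    qed (rule bd)
    also have "\<dots> \<le> (\<Sum>i. ennreal (L ^ s) * ?v (C i))"
    proof (rule suminf_le)
      fix i
      show "?w (C' i) \<le> ennreal (L ^ s) * ?v (C i)"
      proof (cases "C' i = {}")
        case False
        have "(diameter (C' i) / 2) ^ s \<le> L ^ s * (diameter (C i) / 2) ^ s"
          unfolding power_mult_distrib[symmetric] using diam[of i] bd[of i] by (intro power_mono) (auto simp: diameter_ge_0)
        then have "unit_ball_vol (real s) * (diameter (C' i) / 2) ^ s
                   \<le> L ^ s * (unit_ball_vol (real s) * (diameter (C i) / 2) ^ s)"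
          by (subst mult.left_commute) (rule mult_left_mono, auto)
        moreover have "C i \<noteq> {}" "0 \<le> L ^ s"
          using False \<open>L > 0\<close> by (auto simp: C'_def)
        ultimately show ?thesis
          using False by (simp only: if_False ennreal_mult'[symmetric] ennreal_leI)
      qed simp
    qed auto
    also have "\<dots> = ennreal (L ^ s) * (\<Sum>i. ?v (C i))"
      by simp
    finally show ?thesis
      using \<open>L > 0\<close> by (subst (asm) ennreal_le_cmult_iff) auto
  qed
  then have "ennreal (1 / L ^ s) * hausdorff_premeasure s (L * \<delta>) (f ` A) \<le> hausdorff_premeasure s \<delta> A"
    unfolding hausdorff_premeasure_def[of s \<delta> A] by (intro INF_greatest) auto
  then show ?thesis
    using \<open>L > 0\<close> by (subst ennreal_le_cmult_iff) auto
qed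

text \<open>The mesh sizes \<open>\<delta>\<close> and \<open>\<delta> / L\<close> range over the
  same positive numbers, so the supremum absorbs the rescaling of the mesh.\<close>

lemma hausdorff_outer_lipschitz_image:
  fixes f :: "'a::euclidean_space \<Rightarrow> 'b::euclidean_space"
  assumes "L > 0" and lip: "\<And>x y. x \<in> A \<Longrightarrow> y \<in> A \<Longrightarrow> dist (f x) (f y) \<le> L * dist x y"
  shows "hausdorff_outer s (f ` A) \<le> ennreal (L ^ s) * hausdorff_outer s A"
  unfolding hausdorff_outer_def[of s "f ` A"]
proof (rule SUP_least)
  fix \<delta> :: real assume "\<delta> \<in> {0<..}"
  then have "hausdorff_premeasure s \<delta> (f ` A) \<le> ennreal (L ^ s) * hausdorff_premeasure s (\<delta> / L) A"
    using hausdorff_premeasure_lipschitz_image[OF assms, of A s "\<delta> / L"] \<open>L > 0\<close> by simp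
  also have "\<dots> \<le> ennreal (L ^ s) * hausdorff_outer s A"
    unfolding hausdorff_outer_def
    by (intro mult_left_mono SUP_upper) (use \<open>\<delta> \<in> {0<..}\<close> \<open>L > 0\<close> in auto)
  finally show "hausdorff_premeasure s \<delta> (f ` A) \<le> ennreal (L ^ s) * hausdorff_outer s A" .
qed

lemma hausdorff_outer_mono: "A \<subseteq> B \<Longrightarrow> hausdorff_outer s A \<le> hausdorff_outer s B"
  unfolding hausdorff_outer_def hausdorff_premeasure_def
  by (intro SUP_mono' INF_superset_mono) auto

text \<open>A homothety and its inverse are Lipschitz with reciprocal constants, so the two
  one-sided bounds close up to an equality.\<close>

lemma hausdorff_outer_scaleR:
  fixes A :: "'a::euclidean_space set"
  assumes "c > 0"
  shows "hausdorff_outer s ((*\<^sub>R) c ` A) = ennreal (c ^ s) * hausdorff_outer s A"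
proof (rule antisym)
  show "hausdorff_outer s ((*\<^sub>R) c ` A) \<le> ennreal (c ^ s) * hausdorff_outer s A"
    using assms by (intro hausdorff_outer_lipschitz_image) (auto simp: dist_norm simp flip: scaleR_diff_right)
  have "hausdorff_outer s ((*\<^sub>R) (1 / c) ` (*\<^sub>R) c ` A)
          \<le> ennreal ((1 / c) ^ s) * hausdorff_outer s ((*\<^sub>R) c ` A)"
    using assms by (intro hausdorff_outer_lipschitz_image) (auto simp: dist_norm simp flip: scaleR_diff_right)
  also have "(*\<^sub>R) (1 / c) ` (*\<^sub>R) c ` A = A"
    using assms by (simp add: image_image)
  finally show "ennreal (c ^ s) * hausdorff_outer s A \<le> hausdorff_outer s ((*\<^sub>R) c ` A)"
    using assms ennreal_le_cmult_iff[of "(1 / c) ^ s"] by (simp add: power_one_over)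
qed

text \<open>Covering by \<open>N\<^sup>k\<close> cubes of side \<open>2 R / N\<close>.\<close>

lemma hausdorff_outer_bounded_subspace:
  fixes S :: "'a::euclidean_space set"
  assumes "subspace S" "bounded A" "A \<subseteq> S"
  shows "hausdorff_outer (dim S) A < \<infinity>"
proof -
  define k where "k = dim S"
  obtain B where B: "B \<subseteq> S" "pairwise orthogonal B" "\<And>x. x \<in> B \<Longrightarrow> norm x = 1"
    "independent B" "card B = k" "span B = S"
    using orthonormal_basis_subspace[OF assms(1)] unfolding k_def by blast
  have finB: "finite B"
    using B(4) by (rule independent_imp_finite)
  obtain R where R: "R > 0" "\<And>x. x \<in> A \<Longrightarrow> norm x \<le> R"
    using assms(2) unfolding bounded_pos by blast
  \<comment> \<open>There will be \<open>N ^ k\<close> cubes, each of half-diameter at most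
    \<open>k * R / N\<close>. The powers of \<open>N\<close> cancel, which makes the bound
    independent of \<open>N\<close> and hence of \<open>\<delta>\<close>.\<close>
  define K where "K = unit_ball_vol (real k) * (k * R) ^ k"
  have pre: "hausdorff_premeasure k \<delta> A \<le> ennreal K" if "\<delta> > 0" for \<delta>
  proof -
    obtain N0 :: nat where "real N0 > 2 * k * R / \<delta>"
      using reals_Archimedean2 by blast
    then obtain N :: nat where N: "real N > 2 * k * R / \<delta>" "N > 0"
      by (intro that[of "Suc N0"]) auto
    define \<I> where "\<I> = B \<rightarrow>\<^sub>E {..<N}"
    have fin: "finite \<I>" and card: "card \<I> = N ^ k"
      using finB B(5) by (auto simp: \<I>_def finite_PiE card_PiE)
    obtain e where e: "bij_betw e {..<N ^ k} \<I>"
      using ex_bij_betw_nat_finite[OF fin] card atLeast0LessThan by metis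
    define Q where "Q m = {x \<in> S. \<forall>b\<in>B. - R + 2 * R * real (m b) / N \<le> x \<bullet> b \<and>
                                    x \<bullet> b \<le> - R + 2 * R * (real (m b) + 1) / N}" for m :: "'a \<Rightarrow> nat"
    \<comment> \<open>The triangle inequality over the \<open>k\<close> coordinates gives
      \<open>k\<close> times the side length. This is cruder than the Euclidean diagonal but enough
      for finiteness.\<close>
    have Qd: "norm (x - y) \<le> k * (2 * R / N)" if "x \<in> Q m" "y \<in> Q m" for x y m
    proof -
      have "x - y \<in> span B"
        using that B(6) assms(1) by (auto simp: Q_def subspace_diff)
      then have eq: "x - y = (\<Sum>b\<in>B. ((x - y) \<bullet> b) *\<^sub>R b)"
        using orthonormal_basis_expand[OF B(2,3) _ finB] by metis
      have "norm (x - y) \<le> (\<Sum>b\<in>B. norm (((x - y) \<bullet> b) *\<^sub>R b))"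
        by (subst eq) (rule norm_sum)
      also have "\<dots> \<le> (\<Sum>b\<in>B. 2 * R / N)"
      proof (rule sum_mono)
        fix b assume b: "b \<in> B"
        then have "\<bar>x \<bullet> b - y \<bullet> b\<bar> \<le> 2 * R * (real (m b) + 1) / N - 2 * R * real (m b) / N"
          using that by (force simp: Q_def)
        also have "\<dots> = 2 * R / N"
          by (simp add: ring_distribs flip: diff_divide_distrib)
        finally show "norm (((x - y) \<bullet> b) *\<^sub>R b) \<le> 2 * R / N"
          using b B(3) by (simp add: inner_diff_left)
      qed
      finally show ?thesis
        using B(5) by simp
    qed
    \<comment> \<open>The finite family is padded to a sequence by empty sets. They contribute 0
      even for \<open>k = 0\<close>, thanks to the convention in the premeasure.\<close>
    define C where "C i = (if i < N ^ k then Q (e i) else {})" for i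
    have Cd: "diameter (C i) \<le> k * (2 * R / N)" for i
      by (rule diameter_le) (use R Qd in \<open>auto simp: C_def simp del: times_divide_eq_right split: if_splits\<close>)
    have Cb: "bounded (C i)" for i
      unfolding bounded_two_points
      by (rule exI[of _ "k * (2 * R / N)"]) (use Qd in \<open>auto simp: C_def dist_norm simp del: times_divide_eq_right split: if_splits\<close>)
    have cover: "A \<subseteq> (\<Union>i. C i)"
    proof
      fix x assume x: "x \<in> A"
      \<comment> \<open>The floor locates the cube containing \<open>x\<close>. On the face
        \<open>x \<bullet> b = R\<close> it would return \<open>N\<close>, one past the last index,
        hence the cut at \<open>N - 1\<close>.\<close>
      define m where "m = (\<lambda>b\<in>B. min (N - 1) (nat \<lfloor>(x \<bullet> b + R) * N / (2 * R)\<rfloor>))"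
      have "m \<in> \<I>"
        unfolding m_def \<I>_def restrict_PiE_iff using N(2) by (simp add: min.strict_coboundedI1)
      then have "m \<in> e ` {..<N ^ k}"
        by (simp only: bij_betw_imp_surj_on[OF e])
      then obtain i where i: "i < N ^ k" "e i = m"
        by blast
      have "x \<in> Q m"
        unfolding Q_def
      proof (intro CollectI conjI ballI)
        show "x \<in> S" using x assms(3) by auto
        fix b assume b: "b \<in> B"
        define t where "t = (x \<bullet> b + R) * N / (2 * R)"
        have xb: "x \<bullet> b = - R + 2 * R * t / N"
          using R N by (simp add: t_def field_simps)
        have "\<bar>x \<bullet> b\<bar> \<le> R"
          using Cauchy_Schwarz_ineq2[of x b] B(3)[OF b] R(2)[OF x] by simp
        then have "0 \<le> (x \<bullet> b + R) * N" "(x \<bullet> b + R) * N \<le> (2 * R) * N"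
          by (auto intro!: mult_right_mono mult_nonneg_nonneg simp: abs_le_iff)
        then have t: "0 \<le> t" "t \<le> N"
          using R by (auto simp: t_def pos_divide_le_eq mult.commute)
        have mb: "m b = min (N - 1) (nat \<lfloor>t\<rfloor>)"
          unfolding m_def t_def using b by (rule restrict_apply')
        have "real (m b) \<le> t \<and> t \<le> real (m b) + 1"
        proof (cases "N - 1 \<le> nat \<lfloor>t\<rfloor>")
          case True
          then have "m b = N - 1"
            by (simp only: mb min_def if_True)
          then show ?thesis using t N True by linarith
        next
          case False
          then have "m b = nat \<lfloor>t\<rfloor>"
            by (simp only: mb min_def if_False)
          then show ?thesis using t by linarith
        qed
        then show "- R + 2 * R * real (m b) / N \<le> x \<bullet> b" "x \<bullet> b \<le> - R + 2 * R * (real (m b) + 1) / N"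
          unfolding xb using R N by (auto intro!: divide_right_mono mult_left_mono)
      qed
      then show "x \<in> (\<Union>i. C i)"
        using i by (auto simp: C_def)
    qed
    have "hausdorff_premeasure k \<delta> A
          \<le> (\<Sum>i. if C i = {} then 0 else ennreal (unit_ball_vol (real k) * (diameter (C i) / 2) ^ k))"
      unfolding hausdorff_premeasure_def
    proof (rule INF_lower, safe)
      show "diameter (C i) \<le> \<delta>" for i
      proof -
        have "k * (2 * R / N) < \<delta>"
          using N that by (simp add: field_simps)
        then show ?thesis
          using Cd[of i] by linarith
      qed
    qed (use cover Cb in auto)
    also have "\<dots> = (\<Sum>i<N ^ k. if C i = {} then 0 else
                       ennreal (unit_ball_vol (real k) * (diameter (C i) / 2) ^ k))"
      by (rule suminf_finite) (auto simp: C_def)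
    also have "\<dots> \<le> (\<Sum>i<N ^ k. ennreal (unit_ball_vol (real k) * (k * R / N) ^ k))"
    proof (rule sum_mono)
      fix i
      have "diameter (C i) / 2 \<le> k * R / N"
        using Cd[of i] by (simp add: ac_simps)
      then have "(diameter (C i) / 2) ^ k \<le> (k * R / N) ^ k"
        using Cb[of i] by (intro power_mono) (auto simp: diameter_ge_0)
      then show "(if C i = {} then 0 else ennreal (unit_ball_vol (real k) * (diameter (C i) / 2) ^ k))
                 \<le> ennreal (unit_ball_vol (real k) * (k * R / N) ^ k)"
        by (auto intro!: ennreal_leI mult_left_mono)
    qed
    also have "\<dots> = ennreal K"
      using N R by (simp add: K_def ennreal_of_nat_eq_real_of_nat ennreal_mult'[symmetric] power_divide
            flip: of_nat_power)
    finally show ?thesis .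
  qed
  have "hausdorff_outer k A \<le> ennreal K"
    unfolding hausdorff_outer_def by (rule SUP_least) (use pre in auto)
  then show ?thesis
    by (simp add: k_def le_less_trans[OF _ ennreal_less_top])
qed

section \<open>The Borel measure and change of variables under homotheties\<close>

lemma sets_hausdorff_measure [measurable_cong, simp]: "sets (hausdorff_measure k) = sets borel"
  by (simp add: hausdorff_measure_def sets_measure_of_conv)
    (metis sets.sigma_sets_eq space_borel)

lemma space_hausdorff_measure [simp]: "space (hausdorff_measure k) = UNIV"
  by (simp add: hausdorff_measure_def space_measure_of_conv)

text \<open>If Caratheodory's theorem did not apply, \<open>hausdorff_measure k\<close> would be the null measure by
  the junk value of \<open>measure_of\<close>; everything needed below holds in that case too.\<close>

lemma emeasure_hausdorff_measure_cases:
  "(\<forall>A\<in>sets borel. emeasure (hausdorff_measure k) A = hausdorff_outer k (A :: 'a::euclidean_space set))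
   \<or> (\<forall>A. emeasure (hausdorff_measure k) (A :: 'a set) = 0)"
proof -
  have "sigma_sets UNIV (sets borel) = (sets borel :: 'a set set)"
    by (metis sets.sigma_sets_eq space_borel)
  then show ?thesis
    unfolding hausdorff_measure_def
    by (cases "measure_space UNIV (sets borel) (hausdorff_outer k :: 'a set \<Rightarrow> ennreal)")
      (auto simp: emeasure_measure_of_conv)
qed

lemma emeasure_hausdorff_measure_le:
  "A \<in> sets borel \<Longrightarrow> emeasure (hausdorff_measure k) (A :: 'a::euclidean_space set) \<le> hausdorff_outer k A"
  using emeasure_hausdorff_measure_cases[where ?'a = 'a, of k] by auto

lemma hausdorff_measure_scaleR:
  fixes A :: "'a::euclidean_space set"
  assumes "c > 0" "A \<in> sets borel"
  shows "emeasure (hausdorff_measure k) ((*\<^sub>R) c ` A) = ennreal (c ^ k) * emeasure (hausdorff_measure k) A"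
proof -
  have "(*\<^sub>R) c ` A = (*\<^sub>R) (1 / c) -` A"
    using assms(1) by (force simp: image_iff)
  also have "\<dots> \<in> sets borel"
    using assms(2) by (intro measurable_sets_borel[where M = borel]) auto
  finally have "(*\<^sub>R) c ` A \<in> sets borel" .
  with emeasure_hausdorff_measure_cases[where ?'a = 'a, of k] assms(2) show ?thesis
    by (elim disjE) (simp_all only: hausdorff_outer_scaleR[OF assms(1)] mult_zero_right)
qed

text \<open>Homogeneity on sets, restated as an identity of measures, so that the substitution rules
  for integrals follow from those for \<open>density\<close> and \<open>distr\<close>.\<close>

lemma density_distr_hausdorff_measure_scaleR:
  assumes "c > 0"
  shows "density (distr (hausdorff_measure k) borel ((*\<^sub>R) c)) (\<lambda>_. ennreal (c ^ k))
         = (hausdorff_measure k :: 'a::euclidean_space measure)"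
proof (rule measure_eqI)
  fix A :: "'a set"
  assume "A \<in> sets (density (distr (hausdorff_measure k) borel ((*\<^sub>R) c)) (\<lambda>_. ennreal (c ^ k)))"
  then have A: "A \<in> sets borel" by simp
  have eq: "(*\<^sub>R) c -` A = (*\<^sub>R) (1 / c) ` A"
    using assms by (force simp: image_iff)
  show "emeasure (density (distr (hausdorff_measure k) borel ((*\<^sub>R) c)) (\<lambda>_. ennreal (c ^ k))) A
        = emeasure (hausdorff_measure k) A"
    using A assms
    by (simp add: emeasure_density nn_integral_cmult_indicator emeasure_distr eq hausdorff_measure_scaleR
          power_one_over flip: mult.assoc ennreal_mult')
qed simp

lemma integrable_hausdorff_measure_scaleR:
  fixes g :: "'a::euclidean_space \<Rightarrow> real"
  assumes "c > 0" and [measurable]: "g \<in> borel_measurable borel" and "integrable (hausdorff_measure k) g"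
  shows "integrable (hausdorff_measure k) (\<lambda>x. g (c *\<^sub>R x))"
proof -
  have "integrable (density (distr (hausdorff_measure k) borel ((*\<^sub>R) c)) (\<lambda>_. ennreal (c ^ k))) g"
    unfolding density_distr_hausdorff_measure_scaleR[OF assms(1)] by (rule assms(3))
  then have "integrable (hausdorff_measure k) (\<lambda>x. c ^ k * g (c *\<^sub>R x))"
    using assms(1) by (simp add: integrable_density integrable_distr_eq)
  then show ?thesis
    using assms(1) by simp
qed

lemma integral_hausdorff_measure_scaleR:
  fixes g :: "'a::euclidean_space \<Rightarrow> real"
  assumes "c > 0" and [measurable]: "g \<in> borel_measurable borel"
  shows "(\<integral>x. g (c *\<^sub>R x) \<partial>hausdorff_measure k) = (\<integral>x. g x \<partial>hausdorff_measure k) / c ^ k"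
proof -
  have "(\<integral>x. g x \<partial>hausdorff_measure k) = c ^ k * (\<integral>x. g (c *\<^sub>R x) \<partial>hausdorff_measure k)"
    using assms(1)
    by (subst density_distr_hausdorff_measure_scaleR[OF assms(1), symmetric])
      (simp add: integral_density integral_distr)
  then show ?thesis
    using assms(1) by simp
qed

section \<open>Submanifolds\<close>

lemma Cr_on_mono: "Cr_on r f U \<Longrightarrow> r' \<le> r \<Longrightarrow> Cr_on r' f U"
  by (auto simp: Cr_on_def)

lemma Cr_on_1_iff:
  "Cr_on 1 f U \<longleftrightarrow> continuous_on U f \<and> (\<forall>x\<in>U. f differentiable (at x)) \<and>
     (\<forall>v. continuous_on U (\<lambda>x. frechet_derivative f (at x) v))"
proof -
  have "enat j \<le> 1 \<longleftrightarrow> j = 0 \<or> j = Suc 0" for j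
    by (auto simp: one_enat_def)
  then show ?thesis
    by (simp add: Cr_on_def imp_disjL all_conj_distrib)
qed

lemma Cr_on_1I:
  assumes "\<And>x. x \<in> U \<Longrightarrow> (f has_derivative f' x) (at x)"
    and "\<And>v. continuous_on U (\<lambda>x. f' x v)"
  shows "Cr_on 1 f U"
proof -
  have "frechet_derivative f (at x) = f' x" if "x \<in> U" for x
    using frechet_derivative_at[OF assms(1)[OF that]] by simp
  then have "continuous_on U (\<lambda>x. frechet_derivative f (at x) v)" for v
    using assms(2)[of v] by (simp cong: continuous_on_cong)
  moreover have "\<forall>x\<in>U. f differentiable (at x)"
    using assms(1) differentiableI by blast
  ultimately show ?thesis
    by (auto simp: Cr_on_1_iff intro!: continuous_at_imp_continuous_on differentiable_imp_continuous_within)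
qed

lemma Cr_on_1_has_derivative:
  assumes "Cr_on 1 f U" "x \<in> U"
  shows "(f has_derivative frechet_derivative f (at x)) (at x)"
  using assms by (simp add: Cr_on_1_iff frechet_derivative_works)

text \<open>\<open>Cr_on\<close> gives continuity of the derivative only in a fixed direction.
  Expanding the direction in the standard basis allows it to move with the point.\<close>

lemma continuous_on_frechet_derivative_apply:
  fixes f :: "'a::euclidean_space \<Rightarrow> 'b::real_normed_vector"
  assumes "Cr_on 1 f U" "A \<subseteq> U" "continuous_on A g"
  shows "continuous_on A (\<lambda>x. frechet_derivative f (at x) (g x))"
proof -
  have "frechet_derivative f (at x) (g x)
        = (\<Sum>b\<in>Basis. (g x \<bullet> b) *\<^sub>R frechet_derivative f (at x) b)" if "x \<in> A" for x
  proof -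
    have lin: "linear (frechet_derivative f (at x))"
      using assms that by (auto simp: Cr_on_1_iff intro: linear_frechet_derivative)
    show ?thesis
      by (subst euclidean_representation[of "g x", symmetric])
        (simp only: linear_sum[OF lin] linear_scale[OF lin])
  qed
  moreover have "continuous_on A (\<lambda>x. \<Sum>b\<in>Basis. (g x \<bullet> b) *\<^sub>R frechet_derivative f (at x) b)"
    using assms unfolding Cr_on_1_iff
    by (intro continuous_intros) (auto intro: continuous_on_subset)
  ultimately show ?thesis
    by (simp cong: continuous_on_cong)
qed

text \<open>On a compact ball the finitely many partial derivatives are bounded. Their norms
  dominate the operator norm, and convexity of the ball gives the mean value estimate.\<close>

lemma Cr_on_1_locally_lipschitz:
  fixes f :: "'a::euclidean_space \<Rightarrow> 'b::real_normed_vector"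
  assumes "Cr_on 1 f U" "open U" "q \<in> U"
  obtains r L where "r > 0" "L > 0" "ball q r \<subseteq> U"
    "\<And>x y. x \<in> ball q r \<Longrightarrow> y \<in> ball q r \<Longrightarrow> dist (f x) (f y) \<le> L * dist x y"
proof -
  obtain r where r: "r > 0" "cball q r \<subseteq> U"
    using assms(2,3) open_contains_cball by blast
  let ?s = "\<lambda>x. \<Sum>b\<in>Basis. norm (frechet_derivative f (at x) b)"
  have "continuous_on (cball q r) ?s"
    using assms(1) r(2) unfolding Cr_on_1_iff
    by (intro continuous_intros) (auto intro: continuous_on_subset)
  then have "bounded (?s ` cball q r)"
    by (intro compact_imp_bounded compact_continuous_image compact_cball)
  then obtain L where L: "L > 0" "\<And>x. x \<in> cball q r \<Longrightarrow> norm (?s x) \<le> L"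
    unfolding bounded_pos by auto
  have der: "(f has_derivative frechet_derivative f (at x)) (at x within ball q r)" if "x \<in> ball q r" for x
    using Cr_on_1_has_derivative[OF assms(1)] that r(2) has_derivative_at_withinI ball_subset_cball by blast
  have on: "onorm (frechet_derivative f (at x)) \<le> L" if "x \<in> ball q r" for x
  proof -
    have "onorm (frechet_derivative f (at x)) \<le> ?s x"
      using der[OF that] by (intro onorm_componentwise has_derivative_bounded_linear)
    also have "\<dots> \<le> L"
      using L(2)[of x] that by auto
    finally show ?thesis .
  qed
  show ?thesis
  proof
    show "ball q r \<subseteq> U" using r(2) ball_subset_cball by blast
    show "dist (f x) (f y) \<le> L * dist x y" if "x \<in> ball q r" "y \<in> ball q r" for x y
      unfolding dist_norm using that by (intro differentiable_bound[OF convex_ball der on]) auto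
  qed (use r L in auto)
qed

section \<open>Derivatives along curves and tangent spaces\<close>

lemma has_derivative_along_curve:
  fixes f :: "'a::real_normed_vector \<Rightarrow> 'b::real_normed_vector"
  assumes "(f has_derivative A) (at p within M)"
    and "\<epsilon> > 0" "\<And>t::real. \<bar>t\<bar> < \<epsilon> \<Longrightarrow> \<gamma> t \<in> M" "\<gamma> 0 = p" "(\<gamma> has_vector_derivative v) (at 0)"
  shows "((\<lambda>t. f (\<gamma> t)) has_vector_derivative A v) (at 0)"
proof -
  let ?I = "{-\<epsilon><..<\<epsilon>}"
  have at: "at 0 within ?I = at (0::real)"
    using assms(2) by (intro at_within_open) auto
  have "\<gamma> ` ?I \<subseteq> M"
    using assms(3) by (auto simp: abs_less_iff)
  then have "(f has_derivative A) (at (\<gamma> 0) within \<gamma> ` ?I)"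
    unfolding assms(4) by (rule has_derivative_subset[OF assms(1)])
  moreover have "(\<gamma> has_derivative (\<lambda>t. t *\<^sub>R v)) (at 0 within ?I)"
    using assms(5) by (simp add: at has_vector_derivative_def)
  ultimately have "((\<lambda>t. f (\<gamma> t)) has_derivative (\<lambda>t. A (t *\<^sub>R v))) (at 0 within ?I)"
    using diff_chain_within[of \<gamma> "\<lambda>t. t *\<^sub>R v" 0 ?I f A] by (simp add: o_def)
  moreover have "A (t *\<^sub>R v) = t *\<^sub>R A v" for t
    using assms(1) by (simp add: has_derivative_bounded_linear bounded_linear.linear linear_scale)
  ultimately show ?thesis
    by (simp add: at has_vector_derivative_def)
qed

text \<open>A derivative within \<open>M\<close> need not be unique as a linear map, but its value
  at the velocity of a curve in \<open>M\<close> is the velocity of the image curve.\<close>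

lemma has_derivative_within_unique_on_tangent_space:
  assumes "(f has_derivative A) (at p within M)" "(f has_derivative B) (at p within M)"
    and "v \<in> tangent_space M p"
  shows "A v = B v"
proof -
  obtain \<gamma> and \<epsilon> :: real where \<gamma>: "\<epsilon> > 0" "\<And>t. \<bar>t\<bar> < \<epsilon> \<Longrightarrow> \<gamma> t \<in> M" "\<gamma> 0 = p"
    "(\<gamma> has_vector_derivative v) (at 0)"
    using assms(3) unfolding tangent_space_def by blast
  show ?thesis
    by (rule vector_derivative_unique_at[OF has_derivative_along_curve[OF assms(1) \<gamma>]
          has_derivative_along_curve[OF assms(2) \<gamma>]])
qed

text \<open>Removes the choice hidden in \<open>flat_deriv\<close>: on tangent vectors it can be
  computed from any differentiable local extension. All later computations with
  \<open>flat_deriv\<close> pass through this.\<close>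

lemma flat_deriv_eq:
  assumes "open U" "p \<in> U" "p \<in> M" "(F has_derivative A) (at p)"
    and "\<And>x. x \<in> M \<inter> U \<Longrightarrow> F x = X x" and "v \<in> tangent_space M p"
  shows "flat_deriv M X p v = A v"
proof -
  obtain d where d: "d > 0" "ball p d \<subseteq> U"
    using assms(1,2) open_contains_ball by blast
  have X: "(X has_derivative A) (at p within M)"
    by (rule has_derivative_transform_within[OF has_derivative_at_withinI[OF assms(4)] d(1) assms(3)])
      (use d(2) assms(5) in \<open>auto simp: dist_commute subset_iff\<close>)
  then have "(X has_derivative frechet_derivative X (at p within M)) (at p within M)"
    using differentiableI frechet_derivative_works by blast
  then show ?thesis
    unfolding flat_deriv_def using X assms(6) by (rule has_derivative_within_unique_on_tangent_space)
qed

text \<open>Every vector orthogonal to \<open>S\<close> annihilates the curve near 0, hence also its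
  velocity. The double orthogonal complement of \<open>S\<close> is \<open>S\<close>.\<close>

lemma has_vector_derivative_in_subspace:
  fixes \<gamma> :: "real \<Rightarrow> 'a::euclidean_space"
  assumes "(\<gamma> has_vector_derivative v) (at 0)" "subspace S"
    and "eventually (\<lambda>t. \<gamma> t \<in> S) (nhds 0)"
  shows "v \<in> S"
proof -
  have "n \<bullet> v = 0" if "n \<in> orthogonal_comp S" for n
  proof -
    obtain W where W: "open W" "0 \<in> W" "\<And>t. t \<in> W \<Longrightarrow> \<gamma> t \<in> S"
      using assms(3) unfolding eventually_nhds by blast
    have "((\<lambda>t. n \<bullet> \<gamma> t) has_vector_derivative n \<bullet> v) (at 0)"
      using assms(1) by (rule bounded_linear.has_vector_derivative[OF bounded_linear_inner_right])
    moreover have "((\<lambda>t. n \<bullet> \<gamma> t) has_vector_derivative 0) (at 0)"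
      by (rule has_vector_derivative_transform_within_open[OF has_vector_derivative_const[of 0] W(1,2)])
        (use W(3) that in \<open>auto simp: orthogonal_comp_def orthogonal_def inner_commute\<close>)
    ultimately show ?thesis
      by (rule vector_derivative_unique_at)
  qed
  then have "v \<in> orthogonal_comp (orthogonal_comp S)"
    by (auto simp: orthogonal_comp_def orthogonal_def)
  then show ?thesis
    using orthogonal_comp_self[OF assms(2)] by simp
qed

text \<open>Curves in \<open>M\<close> are sent by \<open>\<Phi>\<close> into the linear space
  \<open>S\<close>, so their velocities land in \<open>S\<close>. Conversely, a straight segment in
  \<open>S\<close> through \<open>\<Phi> p\<close> is pulled back by \<open>\<Psi>\<close> to a
  curve in \<open>M\<close>, and its velocity is the given vector because \<open>B\<close> is a left
  inverse of \<open>A\<close>.\<close>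

lemma tangent_space_eq_chart:
  fixes M :: "'a::euclidean_space set" and \<Phi> \<Psi> :: "'a \<Rightarrow> 'a"
  assumes "open U" "p \<in> U" "p \<in> M" "open V" "homeomorphism U V \<Phi> \<Psi>"
    and "subspace S" "\<Phi> ` (M \<inter> U) = S \<inter> V"
    and A: "(\<Phi> has_derivative A) (at p)" and B: "(\<Psi> has_derivative B) (at (\<Phi> p))"
  shows "tangent_space M p = {v. A v \<in> S}"
proof -
  have \<Psi>\<Phi>: "\<Psi> (\<Phi> x) = x" if "x \<in> U" for x
    using assms(5) that by (simp add: homeomorphism_def)
  have q: "\<Phi> p \<in> S" "\<Phi> p \<in> V"
    using assms(2,3,7) by blast+
  have "((\<lambda>x. \<Psi> (\<Phi> x)) has_derivative (\<lambda>v. B (A v))) (at p)"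
    using diff_chain_at[OF A B] by (simp add: o_def)
  then have "((\<lambda>x. x) has_derivative (\<lambda>v. B (A v))) (at p)"
    by (rule has_derivative_transform_within_open[OF _ assms(1,2)]) (rule \<Psi>\<Phi>)
  then have "(\<lambda>v. B (A v)) = (\<lambda>v. v)"
    by (rule has_derivative_unique[OF _ has_derivative_ident])
  then have BA: "B (A v) = v" for v
    by metis
  show ?thesis
  proof (intro set_eqI iffI)
    fix v assume "v \<in> tangent_space M p"
    then obtain \<gamma> and \<epsilon> :: real where \<gamma>: "\<epsilon> > 0" "\<And>t. \<bar>t\<bar> < \<epsilon> \<Longrightarrow> \<gamma> t \<in> M" "\<gamma> 0 = p"
      "(\<gamma> has_vector_derivative v) (at 0)"
      unfolding tangent_space_def by blast
    have "((\<lambda>t. \<Phi> (\<gamma> t)) has_vector_derivative A v) (at 0)"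
      using has_derivative_along_curve[OF has_derivative_at_withinI[OF A] \<gamma>(1) _ \<gamma>(3,4), of UNIV] by simp
    moreover have "eventually (\<lambda>t. \<Phi> (\<gamma> t) \<in> S) (nhds 0)"
    proof -
      have "(\<gamma> \<longlongrightarrow> \<gamma> 0) (nhds 0)"
        using has_vector_derivative_continuous[OF \<gamma>(4)]
        by (simp only: continuous_at tendsto_at_iff_tendsto_nhds)
      then have "eventually (\<lambda>t. \<gamma> t \<in> U) (nhds 0)"
        using assms(1,2) \<gamma>(3) by (intro topological_tendstoD) auto
      moreover have "eventually (\<lambda>t. \<gamma> t \<in> M) (nhds 0)"
        unfolding eventually_nhds_metric using \<gamma>(1,2) by (intro exI[of _ \<epsilon>]) auto
      ultimately show ?thesis
        by eventually_elim (use assms(7) in blast)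
    qed
    ultimately have "A v \<in> S"
      by (rule has_vector_derivative_in_subspace[OF _ assms(6)])
    then show "v \<in> {v. A v \<in> S}"
      by simp
  next
    fix v assume "v \<in> {v. A v \<in> S}"
    then have v: "A v \<in> S" by simp
    obtain \<delta> where \<delta>: "\<delta> > 0" "ball (\<Phi> p) \<delta> \<subseteq> V"
      using assms(4) q(2) open_contains_ball by blast
    \<comment> \<open>Keeps the segment inside the ball around \<open>\<Phi> p\<close>; the summand
      1 covers the case \<open>A v = 0\<close>.\<close>
    define \<epsilon> where "\<epsilon> = \<delta> / (norm (A v) + 1)"
    have "\<epsilon> > 0"
      using \<delta> by (simp add: \<epsilon>_def add_nonneg_pos)
    moreover have "\<Psi> (\<Phi> p + t *\<^sub>R A v) \<in> M" if "\<bar>t\<bar> < \<epsilon>" for t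
    proof -
      have "\<bar>t\<bar> * (norm (A v) + 1) < \<delta>"
        using that by (simp add: \<epsilon>_def pos_less_divide_eq add_nonneg_pos)
      then have "\<bar>t\<bar> * norm (A v) < \<delta>"
        by (simp add: ring_distribs)
      then have "\<Phi> p + t *\<^sub>R A v \<in> S \<inter> V"
        using subsetD[OF \<delta>(2), of "\<Phi> p + t *\<^sub>R A v"] v q(1) assms(6)
        by (simp add: dist_norm subspace_add subspace_scale)
      then show ?thesis
        using \<Psi>\<Phi> unfolding assms(7)[symmetric] by auto
    qed
    moreover have "((\<lambda>t. \<Psi> (\<Phi> p + t *\<^sub>R A v)) has_vector_derivative B (A v)) (at 0)"
    proof (rule has_derivative_along_curve[where f = \<Psi> and \<gamma> = "\<lambda>t. \<Phi> p + t *\<^sub>R A v" and p = "\<Phi> p"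
          and M = UNIV and \<epsilon> = 1 and A = B and v = "A v"])
      show "(\<Psi> has_derivative B) (at (\<Phi> p) within UNIV)"
        using B by simp
      show "((\<lambda>t. \<Phi> p + t *\<^sub>R A v) has_vector_derivative A v) (at 0)"
        by (auto intro!: derivative_eq_intros simp: has_vector_derivative_def)
    qed auto
    ultimately show "v \<in> tangent_space M p"
      unfolding tangent_space_def using \<Psi>\<Phi>[OF assms(2)] BA
      by (intro CollectI exI[of _ "\<lambda>t. \<Psi> (\<Phi> p + t *\<^sub>R A v)"] exI[of _ \<epsilon>]) simp
  qed
qed

lemma submanifold_chart:
  fixes M :: "'a::euclidean_space set"
  assumes "submanifold r k M" "1 \<le> r" "p \<in> M"
  obtains U V S and \<Phi> \<Psi> :: "'a \<Rightarrow> 'a" where "open U" "p \<in> U" "open V" "homeomorphism U V \<Phi> \<Psi>"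
    "Cr_on 1 \<Phi> U" "Cr_on 1 \<Psi> V" "subspace S" "dim S = k" "\<Phi> ` (M \<inter> U) = S \<inter> V"
proof -
  obtain U V S and \<Phi> \<Psi> :: "'a \<Rightarrow> 'a" where c: "open U" "p \<in> U" "open V" "homeomorphism U V \<Phi> \<Psi>"
    "Cr_on r \<Phi> U" "Cr_on r \<Psi> V" "subspace S" "dim S = k" "\<Phi> ` (M \<inter> U) = S \<inter> V"
    using bspec[OF assms(1)[unfolded submanifold_def] assms(3)] by (elim exE conjE)
  show ?thesis
    by (rule that[OF c(1-4) Cr_on_mono[OF c(5) assms(2)] Cr_on_mono[OF c(6) assms(2)] c(7-9)])
qed

text \<open>Closure under addition is not visible from the definition by curves. A chart exhibits
  the tangent space as the linear preimage of a subspace.\<close>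

lemma subspace_tangent_space:
  fixes M :: "'a::euclidean_space set"
  assumes "submanifold r k M" "1 \<le> r" "p \<in> M"
  shows "subspace (tangent_space M p)"
proof -
  obtain U V S and \<Phi> \<Psi> :: "'a \<Rightarrow> 'a" where c: "open U" "p \<in> U" "open V" "homeomorphism U V \<Phi> \<Psi>"
    "Cr_on 1 \<Phi> U" "Cr_on 1 \<Psi> V" "subspace S" "dim S = k" "\<Phi> ` (M \<inter> U) = S \<inter> V"
    using submanifold_chart[OF assms] .
  have "\<Phi> p \<in> V"
    using c(9,2) assms(3) by blast
  have "tangent_space M p = {v. frechet_derivative \<Phi> (at p) v \<in> S}"
    by (rule tangent_space_eq_chart[OF c(1,2) assms(3) c(3,4,7,9) Cr_on_1_has_derivative[OF c(5,2)]
          Cr_on_1_has_derivative[OF c(6) \<open>\<Phi> p \<in> V\<close>]])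
  moreover have "linear (frechet_derivative \<Phi> (at p))"
    using c(2,5) by (auto simp: Cr_on_1_iff intro: linear_frechet_derivative)
  ultimately show ?thesis
    using c(7) linear_subspace_vimage[of _ S] by (simp add: vimage_def)
qed

section \<open>Normal projection and orthonormal tangent frames\<close>

lemma normal_part_eqI:
  fixes M :: "'a::euclidean_space set"
  assumes "subspace (tangent_space M p)" "w \<in> orthogonal_comp (tangent_space M p)" "v - w \<in> tangent_space M p"
  shows "normal_part M p v = w"
  unfolding normal_part_def
proof (rule the_equality)
  fix w' assume w': "w' \<in> orthogonal_comp (tangent_space M p) \<and> v - w' \<in> tangent_space M p"
  have "w' - w \<in> tangent_space M p"
    using subspace_diff[OF assms(1), of "v - w" "v - w'"] assms(3) w' by simp
  moreover have "w' - w \<in> orthogonal_comp (tangent_space M p)"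
    using w' assms(2) by (intro subspace_diff subspace_orthogonal_comp) auto
  ultimately have "orthogonal (w' - w) (w' - w)"
    unfolding orthogonal_comp_def by blast
  then show "w' = w"
    by (simp add: orthogonal_def)
qed (use assms in auto)

lemma normal_part_in:
  fixes M :: "'a::euclidean_space set"
  assumes "subspace (tangent_space M p)"
  shows "normal_part M p v \<in> orthogonal_comp (tangent_space M p)" "v - normal_part M p v \<in> tangent_space M p"
proof -
  have sp: "span (tangent_space M p) = tangent_space M p"
    using assms by (simp add: span_eq_iff)
  obtain y z where yz: "y \<in> tangent_space M p" "\<And>w. w \<in> tangent_space M p \<Longrightarrow> orthogonal z w" "v = y + z"
    using orthogonal_subspace_decomp_exists[of "tangent_space M p" v] unfolding sp by blast
  then have "normal_part M p v = z"
    by (intro normal_part_eqI assms) (auto simp: orthogonal_comp_def orthogonal_commute)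
  with yz show "normal_part M p v \<in> orthogonal_comp (tangent_space M p)"
    "v - normal_part M p v \<in> tangent_space M p"
    by (auto simp: orthogonal_comp_def orthogonal_commute)
qed

lemma normal_part_tangent:
  fixes M :: "'a::euclidean_space set"
  assumes "subspace (tangent_space M p)" "v \<in> tangent_space M p"
  shows "normal_part M p v = 0"
  using assms by (intro normal_part_eqI) (auto simp: orthogonal_comp_def orthogonal_def)

lemma normal_part_scaleR_add_normal:
  fixes M :: "'a::euclidean_space set"
  assumes T: "subspace (tangent_space M p)" and n: "n \<in> orthogonal_comp (tangent_space M p)"
  shows "normal_part M p (c *\<^sub>R v + d *\<^sub>R n) = c *\<^sub>R normal_part M p v + d *\<^sub>R n"
proof (rule normal_part_eqI[OF T])
  show "c *\<^sub>R normal_part M p v + d *\<^sub>R n \<in> orthogonal_comp (tangent_space M p)"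
    using n normal_part_in(1)[OF T] subspace_orthogonal_comp by (metis subspace_add subspace_scale)
  have "c *\<^sub>R (v - normal_part M p v) \<in> tangent_space M p"
    using normal_part_in(2)[OF T] T by (simp add: subspace_scale)
  then show "c *\<^sub>R v + d *\<^sub>R n - (c *\<^sub>R normal_part M p v + d *\<^sub>R n) \<in> tangent_space M p"
    by (simp add: scaleR_diff_right)
qed

lemma inner_normal_part:
  fixes M :: "'a::euclidean_space set"
  assumes "subspace (tangent_space M p)" "n \<in> orthogonal_comp (tangent_space M p)"
  shows "n \<bullet> normal_part M p v = n \<bullet> v"
proof -
  have "orthogonal (v - normal_part M p v) n"
    using assms(2) normal_part_in(2)[OF assms(1)] by (auto simp: orthogonal_comp_def)
  then show ?thesis
    by (simp add: orthogonal_def inner_commute[of _ n] inner_diff_right)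
qed

lemma tangent_frame:
  fixes M :: "'a::euclidean_space set"
  assumes "subspace (tangent_space M p)"
  shows "pairwise orthogonal (tangent_frame M p)" "\<And>b. b \<in> tangent_frame M p \<Longrightarrow> norm b = 1"
    "span (tangent_frame M p) = tangent_space M p" "finite (tangent_frame M p)"
    "tangent_frame M p \<subseteq> tangent_space M p"
proof -
  have "\<exists>B. pairwise orthogonal B \<and> (\<forall>b\<in>B. norm b = 1) \<and> span B = tangent_space M p"
    using orthonormal_basis_subspace[OF assms] by metis
  from someI_ex[OF this, folded tangent_frame_def]
  show 1: "pairwise orthogonal (tangent_frame M p)" "span (tangent_frame M p) = tangent_space M p"
    and 2: "\<And>b. b \<in> tangent_frame M p \<Longrightarrow> norm b = 1"
    by auto
  show "tangent_frame M p \<subseteq> tangent_space M p"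
    using 1(2) span_superset by blast
  have "0 \<notin> tangent_frame M p"
    using 2 by force
  then show "finite (tangent_frame M p)"
    using 1(1) pairwise_orthogonal_independent independent_imp_finite by blast
qed

text \<open>Makes sums over the arbitrarily chosen frame independent of it: contracting with a
  tangent vector \<open>g\<close> reproduces the derivative in direction \<open>g\<close>.\<close>

lemma sum_tangent_frame_linear:
  fixes M :: "'a::euclidean_space set"
  assumes "subspace (tangent_space M p)" "linear A" "g \<in> tangent_space M p"
  shows "(\<Sum>u\<in>tangent_frame M p. (g \<bullet> u) *\<^sub>R A u) = A g"
proof -
  note B = tangent_frame[OF assms(1)]
  have "(\<Sum>u\<in>tangent_frame M p. (g \<bullet> u) *\<^sub>R A u) = A (\<Sum>u\<in>tangent_frame M p. (g \<bullet> u) *\<^sub>R u)"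
    by (simp add: linear_sum[OF assms(2)] linear_scale[OF assms(2)])
  also have "(\<Sum>u\<in>tangent_frame M p. (g \<bullet> u) *\<^sub>R u) = g"
    using B assms(3) by (intro orthonormal_basis_expand) auto
  finally show ?thesis .
qed

lemma norm_scaleR_add_squared:
  "(norm (a *\<^sub>R x + b *\<^sub>R y))\<^sup>2 = a\<^sup>2 * (norm x)\<^sup>2 + 2 * a * b * (y \<bullet> x) + b\<^sup>2 * (y \<bullet> y)"
  unfolding power2_norm_eq_inner
  by (simp add: inner_left_distrib inner_right_distrib inner_commute[of x y] power2_eq_square algebra_simps)

text \<open>By the product rule and normality of \<open>X\<close>, the normal part of the derivative
  of \<open>w X\<close> in direction \<open>u\<close> is \<open>w\<close> times that of
  \<open>X\<close> plus \<open>(g \<bullet> u) X\<close>. After squaring, the projection disappears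
  from the cross term, since it is paired with the normal vector \<open>X p\<close>. Tangency of the
  gradient \<open>g\<close> then lets the frame be summed out.\<close>

lemma sum_norm_normal_deriv_scaleR:
  fixes M :: "'a::euclidean_space set" and w :: "'a \<Rightarrow> real"
  assumes T: "subspace (tangent_space M p)" and "p \<in> M" and X: "normal_field M X"
    and w: "(w has_derivative (\<lambda>v. g \<bullet> v)) (at p)" and g: "g \<in> tangent_space M p"
  shows "(\<Sum>u\<in>tangent_frame M p. (norm (normal_part M p (flat_deriv M (\<lambda>x. w x *\<^sub>R X x) p u)))\<^sup>2)
         = (w p)\<^sup>2 * (\<Sum>u\<in>tangent_frame M p. (norm (normal_part M p (flat_deriv M X p u)))\<^sup>2)
           + 2 * w p * (X p \<bullet> flat_deriv M X p g) + (norm g)\<^sup>2 * (norm (X p))\<^sup>2"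
proof -
  let ?B = "tangent_frame M p"
  note B = tangent_frame[OF T]
  have n: "X p \<in> orthogonal_comp (tangent_space M p)"
    using X \<open>p \<in> M\<close> by (simp add: normal_field_def)
  obtain U F where F: "open U" "p \<in> U" "Cr_on 1 F U" "\<And>x. x \<in> M \<inter> U \<Longrightarrow> F x = X x"
    using X \<open>p \<in> M\<close> unfolding normal_field_def C1_along_def by metis
  define A where "A = frechet_derivative F (at p)"
  have A: "(F has_derivative A) (at p)"
    unfolding A_def using F by (intro Cr_on_1_has_derivative)
  then have linA: "linear A"
    by (simp add: has_derivative_bounded_linear bounded_linear.linear)
  have dX: "flat_deriv M X p u = A u" if "u \<in> tangent_space M p" for u
    using F(1,2) \<open>p \<in> M\<close> A F(4) that by (rule flat_deriv_eq)
  have dwX: "flat_deriv M (\<lambda>x. w x *\<^sub>R X x) p u = w p *\<^sub>R A u + (g \<bullet> u) *\<^sub>R X p"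
    if "u \<in> tangent_space M p" for u
  proof (rule flat_deriv_eq[OF F(1,2) \<open>p \<in> M\<close> _ _ that])
    show "((\<lambda>x. w x *\<^sub>R F x) has_derivative (\<lambda>u. w p *\<^sub>R A u + (g \<bullet> u) *\<^sub>R X p)) (at p)"
      using has_derivative_scaleR[OF w A] F(2,4) \<open>p \<in> M\<close> by simp
  qed (use F(4) in auto)
  \<comment> \<open>The last two terms are written as inner products with
    \<open>(g \<bullet> u) *\<^sub>R A u\<close> and \<open>(g \<bullet> u) *\<^sub>R u\<close>, so
    that summation leaves exactly the frame expansions of \<open>A g\<close> and
    \<open>g\<close>.\<close>
  have "(\<Sum>u\<in>?B. (norm (normal_part M p (flat_deriv M (\<lambda>x. w x *\<^sub>R X x) p u)))\<^sup>2)
        = (\<Sum>u\<in>?B. (w p)\<^sup>2 * (norm (normal_part M p (flat_deriv M X p u)))\<^sup>2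
            + 2 * w p * (X p \<bullet> ((g \<bullet> u) *\<^sub>R A u)) + (X p \<bullet> X p) * (g \<bullet> ((g \<bullet> u) *\<^sub>R u)))"
  proof (rule sum.cong[OF refl])
    fix u assume "u \<in> ?B"
    then have u: "u \<in> tangent_space M p"
      using B(5) by auto
    show "(norm (normal_part M p (flat_deriv M (\<lambda>x. w x *\<^sub>R X x) p u)))\<^sup>2
        = (w p)\<^sup>2 * (norm (normal_part M p (flat_deriv M X p u)))\<^sup>2
            + 2 * w p * (X p \<bullet> ((g \<bullet> u) *\<^sub>R A u)) + (X p \<bullet> X p) * (g \<bullet> ((g \<bullet> u) *\<^sub>R u))"
      unfolding dwX[OF u] dX[OF u] normal_part_scaleR_add_normal[OF T n] norm_scaleR_add_squared
        inner_normal_part[OF T n]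
      by (simp add: power2_eq_square)
  qed
  also have "\<dots> = (w p)\<^sup>2 * (\<Sum>u\<in>?B. (norm (normal_part M p (flat_deriv M X p u)))\<^sup>2)
       + 2 * w p * (X p \<bullet> (\<Sum>u\<in>?B. (g \<bullet> u) *\<^sub>R A u)) + (X p \<bullet> X p) * (g \<bullet> (\<Sum>u\<in>?B. (g \<bullet> u) *\<^sub>R u))"
    by (simp only: sum.distrib inner_sum_right sum_distrib_left)
  also have "(\<Sum>u\<in>?B. (g \<bullet> u) *\<^sub>R A u) = A g"
    using T linA g by (rule sum_tangent_frame_linear)
  also have "(\<Sum>u\<in>?B. (g \<bullet> u) *\<^sub>R u) = g"
    using sum_tangent_frame_linear[OF T linear_ident g] .
  finally show ?thesis
    using dX[OF g] by (simp add: power2_norm_eq_inner)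
qed

section \<open>Integration on cones\<close>

text \<open>Near \<open>\<Phi> p\<close> the inverse chart is Lipschitz, so a neighbourhood in
  \<open>M\<close> lies in the Lipschitz image of a bounded piece of a \<open>k\<close>-dimensional
  subspace.\<close>

lemma submanifold_locally_finite_hausdorff_outer:
  fixes M :: "'a::euclidean_space set"
  assumes "submanifold r k M" "1 \<le> r" "p \<in> M"
  obtains W where "open W" "p \<in> W" "hausdorff_outer k (M \<inter> W) < \<infinity>"
proof -
  obtain U V S and \<Phi> \<Psi> :: "'a \<Rightarrow> 'a" where c: "open U" "p \<in> U" "open V" "homeomorphism U V \<Phi> \<Psi>"
    "Cr_on 1 \<Phi> U" "Cr_on 1 \<Psi> V" "subspace S" "dim S = k" "\<Phi> ` (M \<inter> U) = S \<inter> V"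
    using submanifold_chart[OF assms] .
  have "\<Phi> p \<in> V"
    using c(9,2) assms(3) by blast
  then obtain d L where d: "d > 0" "L > 0" "ball (\<Phi> p) d \<subseteq> V"
    "\<And>x y. x \<in> ball (\<Phi> p) d \<Longrightarrow> y \<in> ball (\<Phi> p) d \<Longrightarrow> dist (\<Psi> x) (\<Psi> y) \<le> L * dist x y"
    using Cr_on_1_locally_lipschitz[OF c(6,3)] by metis
  define W where "W = U \<inter> \<Phi> -` ball (\<Phi> p) d"
  let ?A = "S \<inter> ball (\<Phi> p) d"
  show ?thesis
  proof
    show "open W"
      unfolding W_def using c(1,4) by (intro continuous_open_preimage) (auto simp: homeomorphism_def)
    show "p \<in> W"
      using c(2) d(1) by (simp add: W_def)
    have "M \<inter> W \<subseteq> \<Psi> ` ?A"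
    proof
      fix x assume x: "x \<in> M \<inter> W"
      then have "\<Phi> x \<in> ?A"
        using c(9) unfolding W_def by blast
      moreover have "x = \<Psi> (\<Phi> x)"
        using x c(4) by (simp add: W_def homeomorphism_def)
      ultimately show "x \<in> \<Psi> ` ?A"
        by blast
    qed
    then have "hausdorff_outer k (M \<inter> W) \<le> hausdorff_outer k (\<Psi> ` ?A)"
      by (rule hausdorff_outer_mono)
    also have "\<dots> \<le> ennreal (L ^ k) * hausdorff_outer k ?A"
      using d by (intro hausdorff_outer_lipschitz_image) auto
    also have "\<dots> < \<infinity>"
      using hausdorff_outer_bounded_subspace[OF c(7), of ?A] c(8)
      by (auto simp: ennreal_mult_less_top bounded_Int)
    finally show "hausdorff_outer k (M \<inter> W) < \<infinity>" .
  qed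
qed

text \<open>Finitely many neighbourhoods of finite outer measure cover \<open>K\<close>. The bound
  passes to the Borel measure through the sets \<open>M \<inter> W p\<close>, which are Borel
  because \<open>M\<close> is.\<close>

lemma emeasure_hausdorff_measure_compact_finite:
  fixes M :: "'a::euclidean_space set"
  assumes "submanifold r k M" "1 \<le> r" and M: "M \<in> sets borel" and K: "compact K" "K \<subseteq> M"
  shows "emeasure (hausdorff_measure k) K < \<infinity>"
proof -
  have "\<forall>p\<in>K. \<exists>W. open W \<and> p \<in> W \<and> hausdorff_outer k (M \<inter> W) < \<infinity>"
    using submanifold_locally_finite_hausdorff_outer[OF assms(1,2)] K(2) by (metis subsetD)
  then obtain W where W: "\<And>p. p \<in> K \<Longrightarrow> open (W p)" "\<And>p. p \<in> K \<Longrightarrow> p \<in> W p"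
    "\<And>p. p \<in> K \<Longrightarrow> hausdorff_outer k (M \<inter> W p) < \<infinity>"
    by metis
  have "K \<subseteq> (\<Union>p\<in>K. W p)"
    using W(2) by blast
  then obtain F where F: "F \<subseteq> K" "finite F" "K \<subseteq> (\<Union>p\<in>F. W p)"
    using compactE_image[OF K(1), of K W] W(1) by blast
  have meas: "M \<inter> W p \<in> sets borel" if "p \<in> F" for p
    by (intro sets.Int M borel_open W(1) subsetD[OF F(1) that])
  have "emeasure (hausdorff_measure k) K \<le> emeasure (hausdorff_measure k) (\<Union>p\<in>F. M \<inter> W p)"
  proof (rule emeasure_mono)
    show "K \<subseteq> (\<Union>p\<in>F. M \<inter> W p)"
      using F(3) K(2) by blast
    show "(\<Union>p\<in>F. M \<inter> W p) \<in> sets (hausdorff_measure k)"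
      using F(2) meas by (simp add: sets.finite_UN del: UN_simps)
  qed
  also have "\<dots> \<le> (\<Sum>p\<in>F. emeasure (hausdorff_measure k) (M \<inter> W p))"
    using F(2) meas by (intro emeasure_subadditive_finite) auto
  also have "\<dots> < \<infinity>"
  proof -
    have "emeasure (hausdorff_measure k) (M \<inter> W p) < \<infinity>" if "p \<in> F" for p
      using emeasure_hausdorff_measure_le[OF meas[OF that]] W(3)[of p] F(1) that
      by (auto intro: le_less_trans)
    then show ?thesis
      using F(2) by (simp add: ennreal_sum_less_top less_top)
  qed
  finally show ?thesis .
qed

lemma bounded_on_compact_support:
  fixes g :: "'a::metric_space \<Rightarrow> real"
  assumes "continuous_on M g" "compact K" "K \<subseteq> M" "\<And>x. x \<in> M - K \<Longrightarrow> g x = 0"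
  obtains B where "B > 0" "\<And>x. x \<in> M \<Longrightarrow> \<bar>g x\<bar> \<le> B * indicator K x"
proof -
  have "bounded (g ` K)"
    using assms by (intro compact_imp_bounded compact_continuous_image) (auto intro: continuous_on_subset)
  then obtain B where "B > 0" "\<And>x. x \<in> K \<Longrightarrow> \<bar>g x\<bar> \<le> B"
    unfolding bounded_pos by auto
  then show ?thesis
    using assms(4) by (intro that[of B]) (auto simp: indicator_def)
qed

lemma set_integrable_continuous_compact_support:
  fixes g :: "'a::euclidean_space \<Rightarrow> real"
  assumes "M \<in> sets borel" "continuous_on M g" "compact K" "K \<subseteq> M" "\<And>x. x \<in> M - K \<Longrightarrow> g x = 0"
    and "emeasure (hausdorff_measure k) K < \<infinity>"
  shows "set_integrable (hausdorff_measure k) M g"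
proof -
  obtain B where B: "B > 0" "\<And>x. x \<in> M \<Longrightarrow> \<bar>g x\<bar> \<le> B * indicator K x"
    using bounded_on_compact_support[OF assms(2-5)] by blast
  have "K \<in> sets borel"
    using assms(3) by (rule borel_compact)
  then have "integrable (hausdorff_measure k) (\<lambda>x. B * indicator K x)"
    using assms(6) by (intro integrable_mult_right integrable_real_indicator) auto
  moreover have "(\<lambda>x. indicator M x *\<^sub>R g x) \<in> borel_measurable (hausdorff_measure k)"
    using borel_measurable_continuous_on_indicator[OF assms(1,2)]
    by (simp cong: measurable_cong_sets)
  moreover have "norm (indicator M x *\<^sub>R g x) \<le> norm (B * indicator K x)" for x
    using B(1) B(2)[of x] by (auto simp: indicator_def split: if_splits)
  ultimately show ?thesis
    unfolding set_integrable_def by (rule Bochner_Integration.integrable_bound[OF _ _ AE_I2])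
qed

text \<open>Comparing the integrals of \<open>G\<close> and \<open>G (c x)\<close> as \<open>c \<rightarrow> 1\<close> replaces polar coordinates on
  the cone.\<close>

lemma radial_integration_by_parts:
  fixes G D :: "'a::euclidean_space \<Rightarrow> real"
  assumes M: "M \<in> sets borel" and cone: "\<And>c x. c > 0 \<Longrightarrow> c *\<^sub>R x \<in> M \<longleftrightarrow> x \<in> M"
    and fin: "\<And>K. compact K \<Longrightarrow> K \<subseteq> M \<Longrightarrow> emeasure (hausdorff_measure k) K < \<infinity>"
    and K: "compact K" "K \<subseteq> M"
    and contG: "continuous_on M G" and contD: "continuous_on M D"
    and G0: "\<And>x. x \<in> M - K \<Longrightarrow> G x = 0" and D0: "\<And>x. x \<in> M - K \<Longrightarrow> D x = 0"
    and der: "\<And>x. x \<in> M \<Longrightarrow> ((\<lambda>c. G (c *\<^sub>R x)) has_real_derivative D x) (at 1)"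
  shows "(LINT x:M|hausdorff_measure k. D x) = - real k * (LINT x:M|hausdorff_measure k. G x)"
proof -
  let ?\<mu> = "hausdorff_measure k :: 'a measure"
  define g where "g x = indicator M x * G x" for x
  \<comment> \<open>A sequence of factors, as dominated convergence requires. Approaching 1 from
    above suffices, since both limits below are taken along the same sequence.\<close>
  define c where "c n = 1 + inverse (real (Suc n))" for n
  define s where "s n x = (g (c n *\<^sub>R x) - g x) / (c n - 1)" for n x
  have c1: "1 < c n" "c n \<le> 2" for n
    by (auto simp: c_def field_simps)
  have clim: "filterlim c (at 1) sequentially"
  proof (rule filterlim_atI)
    show "c \<longlonglongrightarrow> 1"
      unfolding c_def by (rule LIMSEQ_inverse_real_of_nat_add)
    show "eventually (\<lambda>n. c n \<noteq> 1) sequentially"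
      using c1(1) by (intro always_eventually allI) (metis less_irrefl)
  qed
  have ind: "indicator M (a *\<^sub>R x) = (indicator M x :: real)" if "a > 0" for a x
    using cone[OF that] by (simp add: indicator_def)
  have g_meas [measurable]: "g \<in> borel_measurable borel"
    unfolding g_def using borel_measurable_continuous_on_indicator[OF M contG] by simp
  have g_int: "integrable ?\<mu> g"
    using set_integrable_continuous_compact_support[OF M contG K G0 fin[OF K]]
    by (simp add: set_integrable_def g_def[abs_def])
  \<comment> \<open>The hypothesis differentiates only at factor 1. Moving the base point along the
    ray to \<open>a *\<^sub>R x\<close> gives the derivative at every positive factor
    \<open>a\<close>.\<close>
  have der_at: "((\<lambda>c. G (c *\<^sub>R x)) has_real_derivative D (a *\<^sub>R x) / a) (at a)"
    if "x \<in> M" "a > 0" for x a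
  proof -
    have "((\<lambda>c. G (c *\<^sub>R (a *\<^sub>R x))) has_real_derivative D (a *\<^sub>R x)) (at (a / a))"
      using der[of "a *\<^sub>R x"] cone that by simp
    then have "((\<lambda>c. G ((c / a) *\<^sub>R (a *\<^sub>R x))) has_real_derivative D (a *\<^sub>R x) * (1 / a)) (at a)"
      by (rule DERIV_chain2[where g = "\<lambda>c. c / a"])
        (use that in \<open>auto intro!: derivative_eq_intros\<close>)
    then show ?thesis
      using that by simp
  qed
  \<comment> \<open>By the mean value theorem a quotient \<open>s n x\<close> is nonzero only if
    \<open>z *\<^sub>R x \<in> K\<close> for some \<open>z\<close> between 1 and
    \<open>c n \<le> 2\<close>. Then \<open>x\<close> is \<open>1 / z\<close> times a point of
    \<open>K\<close>, with \<open>1 / z\<close> in \<open>{1/2..1}\<close>. So one compact set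
    \<open>K'\<close> supports all quotients, and a multiple of its indicator dominates
    them.\<close>
  define K' where "K' = (\<lambda>(t, x). t *\<^sub>R x) ` ({1/2..1} \<times> K)"
  have K': "compact K'" "K' \<subseteq> M"
  proof -
    show "compact K'"
      unfolding K'_def using K(1)
      by (intro compact_continuous_image compact_Times)
        (auto simp: case_prod_beta intro!: continuous_intros)
    show "K' \<subseteq> M"
      unfolding K'_def using K(2) cone by (auto simp: subset_iff)
  qed
  obtain B where B: "B > 0" "\<And>x. x \<in> M \<Longrightarrow> \<bar>D x\<bar> \<le> B * indicator K x"
    using bounded_on_compact_support[OF contD K D0] by blast
  have bound: "norm (s n x) \<le> B * indicator K' x" for n x
  proof (cases "x \<in> M")
    case False
    then show ?thesis
      using B(1) c1[of n] ind[of "c n" x] by (simp add: s_def g_def)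
  next
    case x: True
    have "\<exists>z>1. z < c n \<and> G (c n *\<^sub>R x) - G (1 *\<^sub>R x) = (c n - 1) * (D (z *\<^sub>R x) / z)"
      using c1[of n] x by (intro MVT2 der_at) auto
    then obtain z where z: "1 < z" "z < c n" "G (c n *\<^sub>R x) - G x = (c n - 1) * (D (z *\<^sub>R x) / z)"
      by auto
    then have "s n x = D (z *\<^sub>R x) / z"
      using c1[of n] ind[of "c n" x] x by (simp add: s_def g_def)
    then have "norm (s n x) \<le> \<bar>D (z *\<^sub>R x)\<bar>"
      using z(1) mult_left_mono[of 1 z "\<bar>D (z *\<^sub>R x)\<bar>"] by (simp add: pos_divide_le_eq)
    also have "\<dots> \<le> B * indicator K (z *\<^sub>R x)"
      using B(2) cone[of z x] x z(1) by simp
    also have "\<dots> \<le> B * indicator K' x"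
    proof (cases "z *\<^sub>R x \<in> K")
      case True
      have "x = (1 / z) *\<^sub>R (z *\<^sub>R x)"
        using z(1) by simp
      moreover have "1 / z \<in> {1/2..1}"
        using z c1[of n] by (auto simp: field_simps)
      ultimately have "x \<in> K'"
        unfolding K'_def using True by (intro image_eqI[where x = "(1 / z, z *\<^sub>R x)"]) auto
      then show ?thesis
        using B(1) by (simp add: indicator_def)
    qed (use B(1) in auto)
    finally show ?thesis .
  qed
  have lim: "(\<lambda>n. s n x) \<longlonglongrightarrow> indicator M x * D x" for x
  proof (cases "x \<in> M")
    case False
    then have "s n x = 0" for n
      using c1[of n] ind[of "c n" x] by (simp add: s_def g_def)
    with False show ?thesis by simp
  next
    case True
    have "((\<lambda>a. (G (a *\<^sub>R x) - G (1 *\<^sub>R x)) / (a - 1)) \<longlongrightarrow> D x) (at 1)"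
      using der[OF True] by (simp add: has_field_derivative_iff)
    from filterlim_compose[OF this clim]
    have "(\<lambda>n. (G (c n *\<^sub>R x) - G x) / (c n - 1)) \<longlonglongrightarrow> D x"
      by simp
    moreover have "s n x = (G (c n *\<^sub>R x) - G x) / (c n - 1)" for n
      using c1[of n] ind[of "c n" x] True by (simp add: s_def g_def)
    ultimately show ?thesis
      using True by simp
  qed
  have s_meas: "s n \<in> borel_measurable ?\<mu>" for n
    unfolding s_def by measurable
  have D_meas: "(\<lambda>x. indicator M x * D x) \<in> borel_measurable ?\<mu>"
    using borel_measurable_continuous_on_indicator[OF M contD] by (simp cong: measurable_cong_sets)
  have "K' \<in> sets borel"
    using K'(1) by (rule borel_compact)
  then have w: "integrable ?\<mu> (\<lambda>x. B * indicator K' x)"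
    using fin[OF K'] by (intro integrable_mult_right integrable_real_indicator) auto
  have "(\<lambda>n. integral\<^sup>L ?\<mu> (s n)) \<longlonglongrightarrow> (\<integral>x. indicator M x * D x \<partial>?\<mu>)"
    by (rule integral_dominated_convergence[OF D_meas s_meas w]) (use lim bound in auto)
  moreover have "(\<lambda>n. integral\<^sup>L ?\<mu> (s n)) \<longlonglongrightarrow> - real k * integral\<^sup>L ?\<mu> g"
  proof -
    \<comment> \<open>By homogeneity the integral of \<open>g (c *\<^sub>R x)\<close> is
      \<open>1 / c ^ k\<close> times that of \<open>g\<close>; the factor \<open>- k\<close> is the
      derivative of this power at 1.\<close>
    have "((\<lambda>a. 1 / a ^ k) has_real_derivative - real k) (at 1)"
      by (auto intro!: derivative_eq_intros)
    then have "((\<lambda>a. (1 / a ^ k - 1) / (a - 1)) \<longlongrightarrow> - real k) (at (1::real))"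
      by (simp add: has_field_derivative_iff)
    from filterlim_compose[OF this clim]
    have "(\<lambda>n. (1 / c n ^ k - 1) / (c n - 1) * integral\<^sup>L ?\<mu> g) \<longlonglongrightarrow> - real k * integral\<^sup>L ?\<mu> g"
      by (rule tendsto_mult_right)
    moreover have "integral\<^sup>L ?\<mu> (s n) = (1 / c n ^ k - 1) / (c n - 1) * integral\<^sup>L ?\<mu> g" for n
    proof -
      have "integral\<^sup>L ?\<mu> (s n) = ((\<integral>x. g (c n *\<^sub>R x) \<partial>?\<mu>) - integral\<^sup>L ?\<mu> g) / (c n - 1)"
        unfolding s_def
        using g_int integrable_hausdorff_measure_scaleR[OF _ g_meas g_int, of "c n"] c1[of n] by simp
      also have "(\<integral>x. g (c n *\<^sub>R x) \<partial>?\<mu>) = integral\<^sup>L ?\<mu> g / c n ^ k"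
        using c1[of n] by (intro integral_hausdorff_measure_scaleR g_meas) simp
      finally show ?thesis
        by (simp add: field_simps)
    qed
    ultimately show ?thesis
      by simp
  qed
  ultimately have "(\<integral>x. indicator M x * D x \<partial>?\<mu>) = - real k * integral\<^sup>L ?\<mu> g"
    by (rule LIMSEQ_unique)
  then show ?thesis
    by (simp add: set_lebesgue_integral_def g_def[abs_def])
qed

section \<open>Radial functions and fields\<close>

lemma continuous_on_locally:
  fixes f :: "'a::t2_space \<Rightarrow> 'b::topological_space"
  assumes "\<And>p. p \<in> M \<Longrightarrow> \<exists>U. open U \<and> p \<in> U \<and> continuous_on (M \<inter> U) f"
  shows "continuous_on M f"
  unfolding continuous_on_eq_continuous_within
proof
  fix p assume "p \<in> M"
  then obtain U where U: "open U" "p \<in> U" "continuous_on (M \<inter> U) f"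
    using assms by blast
  then have "continuous (at p within M \<inter> U) f"
    using \<open>p \<in> M\<close> by (simp add: continuous_on_eq_continuous_within)
  moreover have "at p within M \<inter> U = at p within M"
    using U by (intro at_within_nhd[of p U]) auto
  ultimately show "continuous (at p within M) f"
    by simp
qed

lemma C1_along_continuous_on:
  assumes "C1_along M X"
  shows "continuous_on M X"
proof (rule continuous_on_locally)
  fix p assume "p \<in> M"
  then obtain U F where U: "open U" "p \<in> U" "Cr_on 1 F U" "\<forall>x\<in>M \<inter> U. F x = X x"
    using assms unfolding C1_along_def by blast
  have "continuous_on (M \<inter> U) F"
    using U(3) by (auto simp: Cr_on_1_iff intro: continuous_on_subset)
  then have "continuous_on (M \<inter> U) X"
    by (rule continuous_on_eq) (use U(4) in auto)
  then show "\<exists>U. open U \<and> p \<in> U \<and> continuous_on (M \<inter> U) X"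
    using U by blast
qed

text \<open>The derivative within \<open>M\<close> is chosen separately at each point and has no
  continuity of its own. Along a tangent field it coincides locally with the derivative of a
  \<open>C^1\<close> extension.\<close>

lemma continuous_on_flat_deriv:
  assumes "C1_along M X" "continuous_on M Y" "\<And>x. x \<in> M \<Longrightarrow> Y x \<in> tangent_space M x"
  shows "continuous_on M (\<lambda>x. flat_deriv M X x (Y x))"
proof (rule continuous_on_locally)
  fix p assume "p \<in> M"
  then obtain U F where U: "open U" "p \<in> U" "Cr_on 1 F U" "\<forall>x\<in>M \<inter> U. F x = X x"
    using assms(1) unfolding C1_along_def by blast
  have eq: "flat_deriv M X x (Y x) = frechet_derivative F (at x) (Y x)" if "x \<in> M \<inter> U" for x
    using that U assms(3) by (intro flat_deriv_eq[of U _ M F]) (auto intro: Cr_on_1_has_derivative)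
  have "continuous_on (M \<inter> U) (\<lambda>x. frechet_derivative F (at x) (Y x))"
    using U(3) assms(2) by (intro continuous_on_frechet_derivative_apply) (auto intro: continuous_on_subset)
  then have "continuous_on (M \<inter> U) (\<lambda>x. flat_deriv M X x (Y x))"
    by (rule continuous_on_eq) (use eq in auto)
  then show "\<exists>U. open U \<and> p \<in> U \<and> continuous_on (M \<inter> U) (\<lambda>x. flat_deriv M X x (Y x))"
    using U by blast
qed

lemma flat_deriv_scaleR:
  assumes "C1_along M X" "p \<in> M" "subspace (tangent_space M p)" "v \<in> tangent_space M p"
  shows "flat_deriv M X p (c *\<^sub>R v) = c *\<^sub>R flat_deriv M X p v"
proof -
  obtain U F where U: "open U" "p \<in> U" "Cr_on 1 F U" "\<forall>x\<in>M \<inter> U. F x = X x"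
    using assms(1,2) unfolding C1_along_def by blast
  have F: "(F has_derivative frechet_derivative F (at p)) (at p)"
    using U by (intro Cr_on_1_has_derivative)
  have eq: "flat_deriv M X p u = frechet_derivative F (at p) u" if "u \<in> tangent_space M p" for u
    using U F assms(2) that by (intro flat_deriv_eq[of U _ M F]) auto
  have "linear (frechet_derivative F (at p))"
    using F by (simp add: has_derivative_bounded_linear bounded_linear.linear)
  then show ?thesis
    using assms(3,4) by (simp add: eq subspace_scale linear_scale)
qed

lemma normal_field_scaleR:
  fixes w :: "'a::euclidean_space \<Rightarrow> real"
  assumes X: "normal_field M X" and V: "open V" "M \<subseteq> V" "Cr_on 1 w V"
  shows "normal_field M (\<lambda>x. w x *\<^sub>R X x)"
  unfolding normal_field_def C1_along_def
proof (intro conjI ballI)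
  fix p assume "p \<in> M"
  then obtain U F where U: "open U" "p \<in> U" "Cr_on 1 F U" "\<forall>x\<in>M \<inter> U. F x = X x"
    using X unfolding normal_field_def C1_along_def by blast
  have "Cr_on 1 (\<lambda>x. w x *\<^sub>R F x) (U \<inter> V)"
  proof (rule Cr_on_1I)
    show "((\<lambda>x. w x *\<^sub>R F x) has_derivative
            (\<lambda>v. w x *\<^sub>R frechet_derivative F (at x) v + frechet_derivative w (at x) v *\<^sub>R F x)) (at x)"
      if "x \<in> U \<inter> V" for x
      using that U(3) V(3) by (intro has_derivative_scaleR Cr_on_1_has_derivative) auto
    show "continuous_on (U \<inter> V) (\<lambda>x. w x *\<^sub>R frechet_derivative F (at x) v
            + frechet_derivative w (at x) v *\<^sub>R F x)" for v
      using U(3) V(3) unfolding Cr_on_1_iff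
      by (intro continuous_intros) (auto intro: continuous_on_subset)
  qed
  then show "\<exists>U F. open U \<and> p \<in> U \<and> Cr_on 1 F U \<and> (\<forall>x\<in>M \<inter> U. F x = w x *\<^sub>R X x)"
    using U V \<open>p \<in> M\<close> by (intro exI[of _ "U \<inter> V"] exI[of _ "\<lambda>x. w x *\<^sub>R F x"]) auto
next
  fix x assume "x \<in> M"
  then show "w x *\<^sub>R X x \<in> orthogonal_comp (tangent_space M x)"
    using X by (simp add: normal_field_def subspace_scale subspace_orthogonal_comp)
qed

lemma position_in_tangent_space_cone:
  fixes M :: "'a::euclidean_space set"
  assumes cone: "\<And>c x. c > 0 \<Longrightarrow> c *\<^sub>R x \<in> M \<longleftrightarrow> x \<in> M" and "x \<in> M"
  shows "x \<in> tangent_space M x"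
  unfolding tangent_space_def
proof (intro CollectI exI conjI)
  show "((\<lambda>t. (1 + t) *\<^sub>R x) has_vector_derivative x) (at 0)"
    by (auto intro!: derivative_eq_intros simp: has_vector_derivative_def)
  show "\<forall>t::real. \<bar>t\<bar> < 1 \<longrightarrow> (1 + t) *\<^sub>R x \<in> M"
    using assms by (auto simp: abs_less_iff)
qed auto

text \<open>Identifies \<open>flat_deriv M X x x\<close> as the derivative of \<open>X\<close> under
  dilation, that is, \<open>norm x\<close> times the radial derivative. The cone property keeps
  \<open>c *\<^sub>R x\<close> in \<open>M\<close>, so a local extension may replace
  \<open>X\<close> for \<open>c\<close> near 1.\<close>

lemma has_vector_derivative_radial_cone:
  fixes M :: "'a::euclidean_space set"
  assumes cone: "\<And>c x. c > 0 \<Longrightarrow> c *\<^sub>R x \<in> M \<longleftrightarrow> x \<in> M" and X: "C1_along M X" and "x \<in> M"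
  shows "((\<lambda>c. X (c *\<^sub>R x)) has_vector_derivative flat_deriv M X x x) (at 1)"
proof -
  obtain U F where U: "open U" "x \<in> U" "Cr_on 1 F U" "\<forall>x\<in>M \<inter> U. F x = X x"
    using X \<open>x \<in> M\<close> unfolding C1_along_def by blast
  have F: "(F has_derivative frechet_derivative F (at x)) (at x)"
    using U by (intro Cr_on_1_has_derivative)
  have eq: "flat_deriv M X x x = frechet_derivative F (at x) x"
    by (rule flat_deriv_eq[OF U(1,2) \<open>x \<in> M\<close> F _ position_in_tangent_space_cone[OF cone \<open>x \<in> M\<close>]])
      (rule bspec[OF U(4)])
  have lin: "linear (frechet_derivative F (at x))"
    using F by (simp add: has_derivative_bounded_linear bounded_linear.linear)
  have "((\<lambda>c::real. c *\<^sub>R x) has_derivative (\<lambda>t. t *\<^sub>R x)) (at 1)"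
    by (auto intro!: derivative_eq_intros)
  then have "((\<lambda>c. F (c *\<^sub>R x)) has_vector_derivative frechet_derivative F (at x) x) (at 1)"
    using diff_chain_at[of "\<lambda>c. c *\<^sub>R x" "\<lambda>t. t *\<^sub>R x" 1 F "frechet_derivative F (at x)"] F
    by (simp add: has_vector_derivative_def o_def linear_scale[OF lin])
  moreover have "open ({0<..} \<inter> (\<lambda>c. c *\<^sub>R x) -` U)"
    using U(1) by (intro continuous_open_preimage continuous_intros) auto
  ultimately show ?thesis
    unfolding eq
    by (rule has_vector_derivative_transform_within_open) (use U cone \<open>x \<in> M\<close> in auto)
qed

lemma has_derivative_radial:
  fixes y :: "'a::euclidean_space"
  assumes "(a has_real_derivative a') (at (norm y))" "y \<noteq> 0"
  shows "((\<lambda>x. a (norm x)) has_derivative (\<lambda>v. ((a' / norm y) *\<^sub>R y) \<bullet> v)) (at y)"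
proof -
  have "(norm has_derivative (\<lambda>v. v \<bullet> sgn y)) (at y)"
    using assms(2) by (rule has_derivative_norm)
  moreover have "(a has_derivative (*) a') (at (norm y))"
    using assms(1) by (simp add: has_field_derivative_def)
  ultimately have "((\<lambda>x. a (norm x)) has_derivative (\<lambda>v. a' * (v \<bullet> sgn y))) (at y)"
    using has_derivative_compose[of norm _ y UNIV a] by blast
  then show ?thesis
    by (simp add: sgn_div_norm inner_commute divide_inverse mult.assoc)
qed

lemma gradient_eqI:
  fixes f :: "'a::euclidean_space \<Rightarrow> real"
  assumes "(f has_derivative (\<lambda>v. g \<bullet> v)) (at x)"
  shows "gradient f x = g"
  unfolding gradient_def gderiv_def
proof (rule the_equality)
  show "(f has_derivative (\<lambda>v. v \<bullet> g)) (at x)"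
    using assms by (simp add: inner_commute)
  fix D assume "(f has_derivative (\<lambda>v. v \<bullet> D)) (at x)"
  then have "(\<lambda>v. v \<bullet> D) = (\<lambda>v. g \<bullet> v)"
    using assms by (rule has_derivative_unique)
  then show "D = g"
    by (metis inner_commute vector_eq_ldot)
qed

lemma Hess_const [simp]: "Hess (\<lambda>_. c) x v w = 0"
  by (simp add: Hess_def)

text \<open>The derivative in direction \<open>v\<close> is \<open>F' / r\<close> times
  \<open>y \<bullet> v\<close>. Differentiating again at \<open>x\<close>, the term in which
  \<open>F' / r\<close> is differentiated carries the factor
  \<open>x \<bullet> v = 0\<close>.\<close>

lemma Hess_radial_orthogonal:
  fixes x :: "'a::euclidean_space"
  assumes F: "\<And>t. t > 0 \<Longrightarrow> (F has_real_derivative F' t) (at t)"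
    and F': "(F' has_real_derivative c) (at (norm x))" and "x \<noteq> 0" "x \<bullet> v = 0"
  shows "Hess (\<lambda>x. F (norm x)) x v v = F' (norm x) / norm x * (norm v)\<^sup>2"
proof -
  define q where "q t = F' t / t" for t
  have q: "(q has_real_derivative (c * norm x - F' (norm x)) / (norm x)\<^sup>2) (at (norm x))"
    unfolding q_def using F' \<open>x \<noteq> 0\<close>
    by (auto intro!: derivative_eq_intros simp: power2_eq_square)
  have fd: "frechet_derivative (\<lambda>x. F (norm x)) (at y) v = q (norm y) * (y \<bullet> v)" if "y \<noteq> 0" for y
    using frechet_derivative_at[OF has_derivative_radial[OF F that], symmetric] that
    by (simp add: q_def)
  have "((\<lambda>y. q (norm y) * (y \<bullet> v)) has_derivative
      (\<lambda>u. q (norm x) * (u \<bullet> v)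
        + (((c * norm x - F' (norm x)) / (norm x)\<^sup>2 / norm x) *\<^sub>R x \<bullet> u) * (x \<bullet> v))) (at x)"
    by (rule has_derivative_mult[OF has_derivative_radial[OF q \<open>x \<noteq> 0\<close>]])
      (auto intro!: derivative_eq_intros)
  then have "((\<lambda>y. q (norm y) * (y \<bullet> v)) has_derivative (\<lambda>u. q (norm x) * (u \<bullet> v))) (at x)"
    using \<open>x \<bullet> v = 0\<close> by simp
  then have "((\<lambda>y. frechet_derivative (\<lambda>x. F (norm x)) (at y) v) has_derivative (\<lambda>u. q (norm x) * (u \<bullet> v))) (at x)"
    by (rule has_derivative_transform_within_open[where s = "- {0}"]) (use \<open>x \<noteq> 0\<close> fd in auto)
  then have "Hess (\<lambda>x. F (norm x)) x v v = q (norm x) * (v \<bullet> v)"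
    unfolding Hess_def using frechet_derivative_at by metis
  then show ?thesis
    by (simp add: q_def power2_norm_eq_inner)
qed

lemma frechet_derivative_real_1:
  assumes "f differentiable (at x)"
  shows "frechet_derivative f (at x) 1 = deriv f (x::real)" "(f has_real_derivative deriv f x) (at x)"
proof -
  show *: "(f has_real_derivative deriv f x) (at x)"
    using assms by (simp add: DERIV_deriv_iff_real_differentiable)
  then show "frechet_derivative f (at x) 1 = deriv f x"
    using frechet_derivative_at[of f "(*) (deriv f x)"] by (metis has_field_derivative_def mult.right_neutral)
qed

lemma Cr_on_2_real:
  fixes h :: "real \<Rightarrow> real"
  assumes "Cr_on 2 h U" "open U"
  shows "\<And>t. t \<in> U \<Longrightarrow> (h has_real_derivative deriv h t) (at t)"
    and "\<And>t. t \<in> U \<Longrightarrow> (deriv h has_real_derivative deriv (deriv h) t) (at t)"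
    and "continuous_on U (deriv (deriv h))"
proof -
  define g where "g = (\<lambda>x. frechet_derivative h (at x) 1)"
  have "nat_Cr_on (Suc (Suc 0)) h U"
    using assms(1) by (simp add: Cr_on_def numeral_eq_enat flip: numeral_2_eq_2)
  then have h: "\<And>t. t \<in> U \<Longrightarrow> h differentiable (at t)" and g: "\<And>t. t \<in> U \<Longrightarrow> g differentiable (at t)"
    and cont: "continuous_on U (\<lambda>x. frechet_derivative g (at x) 1)"
    unfolding g_def by auto
  show "(h has_real_derivative deriv h t) (at t)" if "t \<in> U" for t
    using frechet_derivative_real_1(2)[OF h[OF that]] .
  have gh: "g t = deriv h t" if "t \<in> U" for t
    unfolding g_def using frechet_derivative_real_1(1)[OF h[OF that]] .
  have "(deriv h has_real_derivative deriv g t) (at t)" if "t \<in> U" for t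
    using frechet_derivative_real_1(2)[OF g[OF that]] assms(2) that gh
    by (rule has_field_derivative_transform_within_open)
  then have 1: "(deriv h has_real_derivative deriv g t) (at t)" "deriv (deriv h) t = deriv g t" if "t \<in> U" for t
    using that DERIV_imp_deriv by blast+
  then show "(deriv h has_real_derivative deriv (deriv h) t) (at t)" if "t \<in> U" for t
    using that by simp
  have "deriv (deriv h) t = frechet_derivative g (at t) 1" if "t \<in> U" for t
    using frechet_derivative_real_1(1)[OF g[OF that]] 1(2)[OF that] by simp
  then show "continuous_on U (deriv (deriv h))"
    using cont by (simp cong: continuous_on_cong)
qed

lemma cone_over_scaleR:
  assumes "c > 0"
  shows "c *\<^sub>R x \<in> cone_over S - {0} \<longleftrightarrow> x \<in> cone_over S - {0}"
proof -
  have "c *\<^sub>R y \<in> cone_over S" if "c \<ge> 0" "y \<in> cone_over S" for c y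
    using that unfolding cone_over_def by clarsimp (metis mult_nonneg_nonneg)
  from this[of c x] this[of "1 / c" "c *\<^sub>R x"] assms show ?thesis
    by auto
qed

text \<open>The regular part is the preimage of the compact set \<open>S\<close> under radial
  projection. That map sends the origin to 0, which is not on the unit sphere, so the vertex is left
  out.\<close>

lemma cone_over_borel:
  fixes S :: "'a::euclidean_space set"
  assumes "compact S" "S \<subseteq> sphere 0 1"
  shows "cone_over S - {0} \<in> sets borel"
proof -
  have "cone_over S - {0} = (\<lambda>x. inverse (norm x) *\<^sub>R x) -` S"
  proof (intro set_eqI iffI)
    fix x assume "x \<in> cone_over S - {0}"
    then obtain t y where "x = t *\<^sub>R y" "t > 0" "y \<in> S"
      unfolding cone_over_def by force
    moreover have "norm y = 1"
      using \<open>y \<in> S\<close> assms(2) by auto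
    ultimately show "x \<in> (\<lambda>x. inverse (norm x) *\<^sub>R x) -` S"
      by simp
  next
    fix x assume x: "x \<in> (\<lambda>x. inverse (norm x) *\<^sub>R x) -` S"
    then have "x \<noteq> 0"
      using assms(2) by force
    moreover have "x = norm x *\<^sub>R (inverse (norm x) *\<^sub>R x)"
      using \<open>x \<noteq> 0\<close> by simp
    ultimately show "x \<in> cone_over S - {0}"
      using x unfolding cone_over_def vimage_eq by (blast intro: norm_ge_zero)
  qed
  also have "\<dots> \<in> sets borel"
    using assms(1) by (intro measurable_sets_borel[where M = borel]) (auto intro: borel_compact)
  finally show ?thesis .
qed

section \<open>Stability\<close>

lemma set_lebesgue_integral_not_integrable:
  "\<not> set_integrable M A f \<Longrightarrow> (LINT x:A|M. f x) = 0"
  unfolding set_integrable_def set_lebesgue_integral_def by (rule not_integrable_integral_eq)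

text \<open>Right minus left is a nonnegative multiple of the expression in (A-3) with n = k + 1.
  The coefficient \<open>2 * (k + 1)\<close> of \<open>h1\<close> is 4 - 2 + 2k: 4 from the Hessian
  term, -2 from differentiating \<open>1 / t\<close> in the weight \<open>E * h1 / t\<close>, and 2k
  from the scaling exponent of the measure.\<close>

lemma radial_weight_inequality:
  fixes t h1 h2 E N k :: real
  assumes "t > 0" "E > 0" "N \<ge> 0" "t * h1\<^sup>2 + 2 * t * h2 + 2 * (k + 1) * h1 \<ge> 0"
  shows "E * h1\<^sup>2 / 4 * N - (1 / 2) * t * (E * (h1\<^sup>2 / t + h2 / t - h1 / t\<^sup>2)) * N
           - k * ((1 / 2) * (E * h1 / t) * N) \<le> E * h1 / t * N"
proof -
  have "E * h1 / t * N - (E * h1\<^sup>2 / 4 * N - (1 / 2) * t * (E * (h1\<^sup>2 / t + h2 / t - h1 / t\<^sup>2)) * N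
           - k * ((1 / 2) * (E * h1 / t) * N))
        = E * N / (4 * t) * (t * h1\<^sup>2 + 2 * t * h2 + 2 * (k + 1) * h1)"
    using assms(1) by (simp add: field_simps power2_eq_square)
  also have "\<dots> \<ge> 0"
    using assms by (intro mult_nonneg_nonneg) auto
  finally show ?thesis
    by simp
qed

text \<open>\<open>R\<close> is the excess energy density caused by the weight, \<open>Q\<close> the
  Hessian term. The inequality is false pointwise in general, since \<open>R\<close> contains a
  derivative of \<open>X\<close>; it becomes pointwise after subtracting \<open>D + k G\<close>,
  whose integral is zero. Integrability is part of the conclusion because \<open>R\<close> and
  \<open>Q\<close> are later added to a term of unknown integrability.\<close>

lemma radial_energy_inequality:
  fixes M :: "'a::euclidean_space set" and h :: "real \<Rightarrow> real"
  assumes M: "M \<in> sets borel" "0 \<notin> M" and cone: "\<And>c x. c > 0 \<Longrightarrow> c *\<^sub>R x \<in> M \<longleftrightarrow> x \<in> M"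
    and fin: "\<And>K. compact K \<Longrightarrow> K \<subseteq> M \<Longrightarrow> emeasure (hausdorff_measure k) K < \<infinity>"
    and h: "Cr_on 2 h {0<..}"
    and A3: "\<And>t. t > 0 \<Longrightarrow> t * (deriv h t)\<^sup>2 + 2 * t * deriv (deriv h) t + 2 * (real k + 1) * deriv h t \<ge> 0"
    and X: "C1_along M X" and K: "compact K" "K \<subseteq> M" "\<And>x. x \<in> M - K \<Longrightarrow> X x = 0"
  defines "a \<equiv> \<lambda>t. exp (h t) * deriv h t / t"
  defines "R \<equiv> \<lambda>x. a (norm x) * (X x \<bullet> flat_deriv M X x x) + exp (h (norm x)) * (deriv h (norm x))\<^sup>2 / 4 * (norm (X x))\<^sup>2"
  defines "Q \<equiv> \<lambda>x. a (norm x) * (norm (X x))\<^sup>2"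
  shows "set_integrable (hausdorff_measure k) M R" "set_integrable (hausdorff_measure k) M Q"
    "(LINT x:M|hausdorff_measure k. R x) \<le> (LINT x:M|hausdorff_measure k. Q x)"
proof -
  let ?\<mu> = "hausdorff_measure k :: 'a measure"
  note h1 = Cr_on_2_real(1)[OF h open_greaterThan, simplified]
  note h2 = Cr_on_2_real(2)[OF h open_greaterThan, simplified]
  note h3 = Cr_on_2_real(3)[OF h open_greaterThan]
  define a' where "a' t = exp (h t) * ((deriv h t)\<^sup>2 / t + deriv (deriv h) t / t - deriv h t / t\<^sup>2)" for t
  have a: "(a has_real_derivative a' t) (at t)" if "t > 0" for t
    unfolding a_def a'_def using that h1[OF that] h2[OF that]
    by (auto intro!: derivative_eq_intros simp: field_simps power2_eq_square)
  \<comment> \<open>The factor 1/2 makes the dilation derivative \<open>D\<close> of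
    \<open>G\<close> contain exactly the cross term of \<open>R\<close>; its other summand
    differentiates the weight \<open>a\<close>.\<close>
  define G where "G x = (1 / 2) * a (norm x) * (norm (X x))\<^sup>2" for x
  define D where "D x = (1 / 2) * norm x * a' (norm x) * (norm (X x))\<^sup>2
                         + a (norm x) * (X x \<bullet> flat_deriv M X x x)" for x
  have n0: "norm x > 0" if "x \<in> M" for x
    using that M(2) by auto
  have conts: "continuous_on {0<..} h" "continuous_on {0<..} (deriv h)" "continuous_on {0<..} a" "continuous_on {0<..} a'"
  proof -
    show 1: "continuous_on {0<..} h" "continuous_on {0<..} (deriv h)"
      using h1 h2 by (auto intro!: continuous_at_imp_continuous_on DERIV_isCont)
    show "continuous_on {0<..} a"
      using a by (auto intro!: continuous_at_imp_continuous_on DERIV_isCont)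
    show "continuous_on {0<..} a'"
      unfolding a'_def using 1 h3 by (intro continuous_intros) auto
  qed
  have comp: "continuous_on M (\<lambda>x. b (norm x))" if "continuous_on {0<..} b" for b :: "real \<Rightarrow> real"
    by (rule continuous_on_compose2[OF that]) (use n0 in \<open>auto intro!: continuous_intros\<close>)
  have contX: "continuous_on M X"
    using X by (rule C1_along_continuous_on)
  have contdX: "continuous_on M (\<lambda>x. flat_deriv M X x x)"
    using X by (rule continuous_on_flat_deriv)
      (use position_in_tangent_space_cone[OF cone] in \<open>auto intro: continuous_intros\<close>)
  have contR: "continuous_on M R" and contQ: "continuous_on M Q" and contG: "continuous_on M G"
    and contD: "continuous_on M D"
    unfolding R_def Q_def G_def D_def by (intro continuous_intros comp conts contX contdX; simp)+
  have zero: "R x = 0" "Q x = 0" "G x = 0" "D x = 0" if "x \<in> M - K" for x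
    using K(3)[OF that] by (simp_all add: R_def Q_def G_def D_def)
  note int = set_integrable_continuous_compact_support[OF M(1) _ K(1,2) _ fin[OF K(1,2)]]
  show intR: "set_integrable ?\<mu> M R" and intQ: "set_integrable ?\<mu> M Q"
    by (intro int contR contQ zero; assumption)+
  have intG: "set_integrable ?\<mu> M G" and intD: "set_integrable ?\<mu> M D"
    by (intro int contG contD zero; assumption)+
  have ibp: "(LINT x:M|?\<mu>. D x) = - real k * (LINT x:M|?\<mu>. G x)"
  proof (rule radial_integration_by_parts[OF M(1) cone fin K(1,2) contG contD zero(3,4)])
    fix x assume x: "x \<in> M"
    have dX: "((\<lambda>c. X (c *\<^sub>R x)) has_derivative (\<lambda>t. t *\<^sub>R flat_deriv M X x x)) (at 1)"
      using has_vector_derivative_radial_cone[OF cone X x] by (simp add: has_vector_derivative_def)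
    have "((\<lambda>c. X (c *\<^sub>R x) \<bullet> X (c *\<^sub>R x)) has_real_derivative 2 * (X x \<bullet> flat_deriv M X x x)) (at 1)"
      unfolding has_field_derivative_def
      by (rule derivative_eq_intros dX refl)+ (auto simp: inner_commute)
    moreover have "((\<lambda>c. a (c * norm x)) has_real_derivative a' (norm x) * norm x) (at 1)"
      by (rule DERIV_chain2[where f = a]) (use a n0[OF x] in \<open>auto intro!: derivative_eq_intros\<close>)
    ultimately have "((\<lambda>c. (1 / 2) * a (c * norm x) * (X (c *\<^sub>R x) \<bullet> X (c *\<^sub>R x))) has_real_derivative D x) (at 1)"
      by (auto intro!: derivative_eq_intros simp: D_def power2_norm_eq_inner)
    then show "((\<lambda>c. G (c *\<^sub>R x)) has_real_derivative D x) (at 1)"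
      by (rule has_field_derivative_transform_within_open[where S = "{0<..}"])
        (auto simp: G_def power2_norm_eq_inner)
  qed auto
  \<comment> \<open>The cross terms of \<open>R\<close> and \<open>D\<close> cancel, so the new
    integrand involves no derivative of \<open>X\<close>.\<close>
  have "(LINT x:M|?\<mu>. R x) = (LINT x:M|?\<mu>. R x - D x - real k * G x)"
    using intR intD intG ibp by (simp add: set_integral_diff)
  also have "\<dots> \<le> (LINT x:M|?\<mu>. Q x)"
  proof (rule set_integral_mono)
    show "set_integrable ?\<mu> M (\<lambda>x. R x - D x - real k * G x)"
      using intR intD intG by (intro set_integral_diff set_integrable_mult_right)
    fix x assume x: "x \<in> M"
    show "R x - D x - real k * G x \<le> Q x"
      using radial_weight_inequality[OF n0[OF x] exp_gt_zero[of "h (norm x)"] zero_le_power2[of "norm (X x)"] A3[OF n0[OF x]]]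
      unfolding R_def D_def G_def Q_def a_def a'_def by simp
  qed (rule intQ)
  finally show "(LINT x:M|?\<mu>. R x) \<le> (LINT x:M|?\<mu>. Q x)" .
qed

lemma f_stable_hypercone_radial:
  fixes h :: "real \<Rightarrow> real"
    and C :: "'a::euclidean_space set"
  assumes dim: "DIM('a) \<ge> 2"
    and C2: "Cr_on 2 h {0<..}"
    and A3: "\<And>t. t > 0 \<Longrightarrow>
          t * (deriv h t)\<^sup>2 + 2 * t * deriv (deriv h) t + 2 * real DIM('a) * deriv h t \<ge> 0"
    and minimal: "minimal_hypercone C"
    and stable: "stable_hypercone C"
  shows "f_stable_hypercone (\<lambda>x. exp (h (norm x))) C"
proof -
  define M where "M = C - {0}"
  define k where "k = DIM('a) - 1"
  let ?\<mu> = "hausdorff_measure k :: 'a measure"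
  let ?f = "\<lambda>x::'a. exp (h (norm x))"
  obtain S where S: "compact S" "S \<subseteq> sphere 0 1" "C = cone_over S"
    using minimal unfolding minimal_hypercone_def closed_minimal_hypersurface_of_sphere_def by blast
  have M_borel: "M \<in> sets borel"
    unfolding M_def S(3) using S(1,2) by (rule cone_over_borel)
  have cone: "c *\<^sub>R x \<in> M \<longleftrightarrow> x \<in> M" if "c > 0" for c x
    unfolding M_def S(3) using that by (rule cone_over_scaleR)
  have [simp]: "M \<inter> - {0} = M"
    by (auto simp: M_def)
  have n0: "x \<noteq> 0" "norm x > 0" if "x \<in> M" for x
    using that by (auto simp: M_def)
  have st: "f_stable k (- {0}) (\<lambda>_. 1) M"
    using stable by (simp add: stable_hypercone_def f_stable_hypercone_def M_def k_def)
  then have sub: "submanifold 2 k M"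
    and stat: "\<And>x. x \<in> M \<Longrightarrow> mean_curvature M x = normal_part M x (gradient (\<lambda>_. 1) x)"
    by (simp_all add: f_stable_def f_stationary_def)
  have T: "subspace (tangent_space M x)" if "x \<in> M" for x
    using sub _ that by (rule subspace_tangent_space) simp
  have xT: "x \<in> tangent_space M x" if "x \<in> M" for x
    using position_in_tangent_space_cone[OF cone that] .
  \<comment> \<open>Read off from the Euler-Lagrange equation for density 1 contained in area
    stability, which avoids relating the curvature of the cone to that of its link in the
    sphere.\<close>
  have H0: "mean_curvature M x = 0" if "x \<in> M" for x
  proof -
    have "gradient (\<lambda>_. 1) x = 0"
      by (rule gradient_eqI) simp
    then show ?thesis
      using stat that normal_part_tangent[OF T[OF that] subspace_0[OF T[OF that]]] by simp
  qed
  note h1 = Cr_on_2_real(1)[OF C2 open_greaterThan, simplified]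
  note h2 = Cr_on_2_real(2)[OF C2 open_greaterThan, simplified]
  have F: "((\<lambda>t. exp (h t)) has_real_derivative exp (h t) * deriv h t) (at t)" if "t > 0" for t
    using h1[OF that] by (auto intro!: derivative_eq_intros)
  have F': "((\<lambda>t. exp (h t) * deriv h t) has_real_derivative
              exp (h t) * ((deriv h t)\<^sup>2 + deriv (deriv h) t)) (at t)" if "t > 0" for t
    using h1[OF that] h2[OF that]
    by (auto intro!: derivative_eq_intros simp: field_simps power2_eq_square)
  have stationary: "f_stationary k (- {0}) ?f M"
    unfolding f_stationary_def
  proof (intro conjI ballI sub)
    fix x assume "x \<in> M \<inter> - {0}"
    then have x: "x \<in> M" by simp
    have "gradient ?f x = (exp (h (norm x)) * deriv h (norm x) / norm x) *\<^sub>R x"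
      using has_derivative_radial[OF F[OF n0(2)[OF x]] n0(1)[OF x]] by (rule gradient_eqI)
    then have "gradient ?f x \<in> tangent_space M x"
      using T[OF x] xT[OF x] by (simp add: subspace_scale)
    then show "?f x *\<^sub>R mean_curvature M x = normal_part M x (gradient ?f x)"
      using H0[OF x] T[OF x] by (simp add: normal_part_tangent)
  qed
  have fin: "emeasure ?\<mu> K < \<infinity>" if "compact K" "K \<subseteq> M" for K
    using sub _ M_borel that by (rule emeasure_hausdorff_measure_compact_finite) simp
  define w where "w x = exp (h (norm x) / 2)" for x :: 'a
  define g where "g x = (w x * deriv h (norm x) / 2 / norm x) *\<^sub>R x" for x :: 'a
  have w: "(w has_derivative (\<lambda>v. g x \<bullet> v)) (at x)" if "x \<noteq> 0" for x
    unfolding w_def g_def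
    by (rule has_derivative_radial) (use that h1[of "norm x"] in \<open>auto intro!: derivative_eq_intros\<close>)
  have w1: "Cr_on 1 w (- {0})"
  proof (rule Cr_on_1I)
    have "continuous_on {0<..} (deriv h)"
      using h2 by (auto intro!: continuous_at_imp_continuous_on DERIV_isCont)
    then have "continuous_on (- {0}) (\<lambda>x::'a. deriv h (norm x))"
      by (rule continuous_on_compose2) (auto intro!: continuous_intros)
    moreover have "continuous_on (- {0}) w"
      using w by (auto intro!: continuous_at_imp_continuous_on has_derivative_continuous)
    ultimately show "continuous_on (- {0}) (\<lambda>x. g x \<bullet> v)" for v
      unfolding g_def by (intro continuous_intros) auto
  qed (use w in auto)
  have ww: "(w x)\<^sup>2 = ?f x" for x
    by (simp add: w_def power2_eq_square flip: exp_add)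
  have "(LINT x:M|?\<mu>. ?f x * ((\<Sum>u\<in>tangent_frame M x. \<Sum>v\<in>tangent_frame M x. (second_ff M x u v \<bullet> X x)\<^sup>2)
                  + (mean_curvature M x \<bullet> X x)\<^sup>2))
        \<le> (LINT x:M|?\<mu>. ?f x * (\<Sum>u\<in>tangent_frame M x. (norm (normal_part M x (flat_deriv M X x u)))\<^sup>2)
           + Hess ?f x (X x) (X x))"
    if X: "normal_field M X" and K: "compact K" "K \<subseteq> M" "\<And>x. x \<in> M - K \<Longrightarrow> X x = 0" for X K
  proof -
    define Y where "Y x = w x *\<^sub>R X x" for x
    define P where "P x = ?f x * (\<Sum>u\<in>tangent_frame M x. (norm (normal_part M x (flat_deriv M X x u)))\<^sup>2)" for x
    define R where "R x = exp (h (norm x)) * deriv h (norm x) / norm x * (X x \<bullet> flat_deriv M X x x)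
        + exp (h (norm x)) * (deriv h (norm x))\<^sup>2 / 4 * (norm (X x))\<^sup>2" for x
    define Q where "Q x = exp (h (norm x)) * deriv h (norm x) / norm x * (norm (X x))\<^sup>2" for x
    \<comment> \<open>\<open>k\<close> is a truncated difference of naturals; the dimension bound
      makes it exact, so that (A-3) takes the form with \<open>k + 1\<close>.\<close>
    have "real DIM('a) = real k + 1"
      using dim by (simp add: k_def)
    then have A3': "t * (deriv h t)\<^sup>2 + 2 * t * deriv (deriv h) t + 2 * (real k + 1) * deriv h t \<ge> 0"
      if "t > 0" for t
      using A3[OF that] by simp
    have "C1_along M X" "0 \<notin> M"
      using X n0 by (auto simp: normal_field_def)
    note RQ = radial_energy_inequality[OF M_borel this(2) cone fin C2 A3' this(1) K, folded R_def Q_def]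
    have Y: "normal_field M Y"
      unfolding Y_def using n0 by (intro normal_field_scaleR[OF X _ _ w1]) auto
    have "\<forall>x\<in>M - K. Y x = 0"
      using K(3) by (simp add: Y_def)
    then have stY: "(LINT x:M|?\<mu>. (\<Sum>u\<in>tangent_frame M x. \<Sum>v\<in>tangent_frame M x. (second_ff M x u v \<bullet> Y x)\<^sup>2)
                  + (mean_curvature M x \<bullet> Y x)\<^sup>2)
        \<le> (LINT x:M|?\<mu>. (\<Sum>u\<in>tangent_frame M x. (norm (normal_part M x (flat_deriv M Y x u)))\<^sup>2))"
      using st Y K(1,2) unfolding f_stable_def by auto
    \<comment> \<open>Every summand is the square of an inner product with the field, so
      \<open>(w x)\<^sup>2 = ?f x\<close> factors out of each.\<close>
    have "(LINT x:M|?\<mu>. ?f x * ((\<Sum>u\<in>tangent_frame M x. \<Sum>v\<in>tangent_frame M x. (second_ff M x u v \<bullet> X x)\<^sup>2)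
                  + (mean_curvature M x \<bullet> X x)\<^sup>2))
          = (LINT x:M|?\<mu>. (\<Sum>u\<in>tangent_frame M x. \<Sum>v\<in>tangent_frame M x. (second_ff M x u v \<bullet> Y x)\<^sup>2)
                  + (mean_curvature M x \<bullet> Y x)\<^sup>2)"
      using M_borel
      by (intro set_lebesgue_integral_cong)
        (simp_all add: Y_def power_mult_distrib ww ring_distribs flip: sum_distrib_left)
    also note stY
    also have "(LINT x:M|?\<mu>. (\<Sum>u\<in>tangent_frame M x. (norm (normal_part M x (flat_deriv M Y x u)))\<^sup>2))
               = (LINT x:M|?\<mu>. P x + R x)"
    proof (rule set_lebesgue_integral_cong)
      show "\<forall>x. x \<in> M \<longrightarrow> (\<Sum>u\<in>tangent_frame M x. (norm (normal_part M x (flat_deriv M Y x u)))\<^sup>2) = P x + R x"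
      proof (intro allI impI)
        fix x assume x: "x \<in> M"
        have g: "g x \<in> tangent_space M x"
          using T[OF x] xT[OF x] by (simp add: g_def subspace_scale)
        have lin: "flat_deriv M X x (g x) = (w x * deriv h (norm x) / 2 / norm x) *\<^sub>R flat_deriv M X x x"
          using X x T[OF x] xT[OF x] unfolding g_def normal_field_def by (intro flat_deriv_scaleR) auto
        \<comment> \<open>As \<open>g x\<close> is \<open>w h' / (2 |x|)\<close> times
          \<open>x\<close>, the two factors \<open>w\<close> combine to f and the 2 cancels.
          Together with the value of \<open>(norm (g x))\<^sup>2\<close> this yields the two
          summands of \<open>R\<close>.\<close>
        have "2 * w x * (X x \<bullet> flat_deriv M X x (g x))
              = ?f x * deriv h (norm x) / norm x * (X x \<bullet> flat_deriv M X x x)"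
          unfolding lin ww[symmetric] by (simp add: power2_eq_square)
        moreover have "(norm (g x))\<^sup>2 = ?f x * (deriv h (norm x))\<^sup>2 / 4"
          using n0[OF x] by (simp add: g_def power_mult_distrib power_divide ww)
        ultimately show "(\<Sum>u\<in>tangent_frame M x. (norm (normal_part M x (flat_deriv M Y x u)))\<^sup>2) = P x + R x"
          unfolding Y_def[abs_def] sum_norm_normal_deriv_scaleR[OF T[OF x] x X w[OF n0(1)[OF x]] g]
          by (simp only: P_def R_def ww add.assoc)
      qed
    qed (use M_borel in simp)
    also have "\<dots> \<le> (LINT x:M|?\<mu>. P x + Q x)"
    \<comment> \<open>Integrability of the frame sum \<open>P\<close> is left open. If it fails,
      neither \<open>P + R\<close> nor \<open>P + Q\<close> is integrable, because \<open>R\<close>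
      and \<open>Q\<close> are; both integrals are then 0 by convention and the inequality is
      trivial.\<close>
    proof (cases "set_integrable ?\<mu> M P")
      case True
      then show ?thesis
        using RQ by (simp add: set_integral_add)
    next
      case False
      have "\<not> set_integrable ?\<mu> M (\<lambda>x. P x + Z x)" if "set_integrable ?\<mu> M Z" for Z
        using set_integral_diff(1)[OF _ that, of "\<lambda>x. P x + Z x"] False by auto
      then show ?thesis
        using RQ(1,2) by (simp add: set_lebesgue_integral_not_integrable)
    qed
    also have "\<dots> = (LINT x:M|?\<mu>. ?f x * (\<Sum>u\<in>tangent_frame M x. (norm (normal_part M x (flat_deriv M X x u)))\<^sup>2)
           + Hess ?f x (X x) (X x))"
    proof (rule set_lebesgue_integral_cong)
      show "\<forall>x. x \<in> M \<longrightarrow> P x + Q x = ?f x * (\<Sum>u\<in>tangent_frame M x. (norm (normal_part M x (flat_deriv M X x u)))\<^sup>2)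
           + Hess ?f x (X x) (X x)"
      proof (intro allI impI)
        fix x assume x: "x \<in> M"
        have "x \<bullet> X x = 0"
          using X x xT[OF x] by (auto simp: normal_field_def orthogonal_comp_def orthogonal_def)
        then show "P x + Q x = ?f x * (\<Sum>u\<in>tangent_frame M x. (norm (normal_part M x (flat_deriv M X x u)))\<^sup>2)
           + Hess ?f x (X x) (X x)"
          using Hess_radial_orthogonal[OF F F'[OF n0(2)[OF x]] n0(1)[OF x]] by (simp add: P_def Q_def)
      qed
    qed (use M_borel in simp)
    finally show ?thesis .
  qed
  then have "f_stable k (- {0}) ?f M"
    unfolding f_stable_def using stationary by auto
  then show ?thesis
    by (simp add: f_stable_hypercone_def M_def k_def)
qed

theorem theorem1p8:
  fixes h :: "real \<Rightarrow> real"
    and C :: "'a::euclidean_space set"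
    and \<nu> :: "'a \<Rightarrow> 'a"
  assumes dim: "DIM('a) \<ge> 2"
    and C2: "Cr_on 2 h {0<..}"
    and A3: "\<And>t. t > 0 \<Longrightarrow>
          t * (deriv h t)\<^sup>2 + 2 * t * deriv (deriv h) t + 2 * real DIM('a) * deriv h t \<ge> 0"
    and A4: "\<And>r. r > 0 \<Longrightarrow>
          (\<integral>\<^sup>+t\<in>{0<..<r}. ennreal (exp (h t) * t ^ (DIM('a) - 2)) \<partial>lborel) < \<infinity>"
    and minimal: "minimal_hypercone C"
    and oriented: "orientation_of (C - {0}) \<nu>"
    and stable: "stable_hypercone C"
  shows "f_stable_hypercone (\<lambda>x. exp (h (norm x))) C"
  using dim C2 A3 minimal stable by (rule f_stable_hypercone_radial)

end
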